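(* Let $\mathcal{S}\subseteq\{0,\pm1\}^2$ define a non-trivial quarter-plane lattice path model, and let $q_n$ be the number of walks of length $n$ in $\mathrm{Q}(\mathcal{S})$ and $K_{\mathcal{S}}=\limsup_n q_n^{1/n}$. Then \[ K_{\mathcal{S}}=\min_{\theta\in[0,\pi/2]}K_{\mathcal{S}}(\theta). \] Moreover, letting $(\alpha,\beta)$ be the critical point of $P(x,y)=\sum_{(i,j)\in\mathcal{S}}x^iy^j$ in $\mathbb{R}^2_{>0}$ (i.e. $P_x(\alpha,\beta)=P_y(\alpha,\beta)=0$), if $\log\alpha/\log\beta\ge0$ the minimum is attained at $\theta^*=\arctan\frac{\log\alpha}{\log\beta}$, and otherwise it is attained at $0$ or at $\pi/2$.
   Context: $\mathrm{Q}=\mathbb{R}_{\ge0}^2$. For a region $\mathrm{R}\subset\mathbb{R}^2$, $\mathrm{R}(\mathcal{S})_n$ is the set of walks $w_1\dots w_n$ with $w_i\in\mathcal{S}$ starting at the origin such that all partial sums $w_1+\dots+w_j$ ($1\le j\le n$) lie in $\mathrm{R}$. A model is non-trivial if it contains a walk of positive length and, for each boundary of the region, some walk touches that boundary. For $\theta\in[0,\pi/2]$, $\mathrm{H}_\theta=\{(x,y): x\sin\theta+y\cos\theta\ge0\}$ and $K_{\mathcal{S}}(\theta)=\limsup_n|\mathrm{H}_\theta(\mathcal{S})_n|^{1/n}$. *)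

theory Defs
  imports "HOL-Analysis.Analysis"
begin

type_synonym step = "int \<times> int"

definition real_point :: "int \<times> int \<Rightarrow> real \<times> real" where
  "real_point p = (real_of_int (fst p), real_of_int (snd p))"

definition position :: "step list \<Rightarrow> nat \<Rightarrow> real \<times> real" where
  "position w j = real_point (sum_list (take j w))"

definition walks :: "(real \<times> real) set \<Rightarrow> step set \<Rightarrow> nat \<Rightarrow> step list set" where
  "walks R S n = {w. length w = n \<and> set w \<subseteq> S \<and> (\<forall>j\<in>{1..n}. position w j \<in> R)}"

definition growth :: "(real \<times> real) set \<Rightarrow> step set \<Rightarrow> ereal" where
  "growth R S = limsup (\<lambda>n. ereal (root n (real (card (walks R S n)))))"

(* Every walk starts on the boundary, namely at the origin, so a touch has to be an arrival:
   the walk must reach a point of B by an actual displacement.  Standing still at the origin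
   by means of the step (0,0), if that step is allowed, is therefore not a touch. *)
definition touches :: "step list \<Rightarrow> (real \<times> real) set \<Rightarrow> bool" where
  "touches w B \<longleftrightarrow> (\<exists>j\<in>{1..length w}. w ! (j - 1) \<noteq> (0, 0) \<and> position w j \<in> B)"

definition nontrivial_model ::
  "(real \<times> real) set \<Rightarrow> (real \<times> real) set set \<Rightarrow> step set \<Rightarrow> bool" where
  "nontrivial_model R boundaries S \<longleftrightarrow>
     (\<exists>n>0. walks R S n \<noteq> {}) \<and>
     (\<forall>B\<in>boundaries. \<exists>n. \<exists>w\<in>walks R S n. touches w B)"

definition quarter_plane :: "(real \<times> real) set" where
  "quarter_plane = {(x, y). 0 \<le> x \<and> 0 \<le> y}"

definition quarter_plane_boundaries :: "(real \<times> real) set set" where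
  "quarter_plane_boundaries = {{(x, y). 0 \<le> x \<and> y = 0}, {(x, y). x = 0 \<and> 0 \<le> y}}"

definition half_plane :: "real \<Rightarrow> (real \<times> real) set" where
  "half_plane \<theta> = {(x, y). 0 \<le> x * sin \<theta> + y * cos \<theta>}"

definition half_plane_growth :: "step set \<Rightarrow> real \<Rightarrow> ereal" where
  "half_plane_growth S \<theta> = growth (half_plane \<theta>) S"

definition step_poly :: "step set \<Rightarrow> real \<Rightarrow> real \<Rightarrow> real" where
  "step_poly S x y = (\<Sum>(i, j)\<in>S. x powi i * y powi j)"

definition critical_point :: "step set \<Rightarrow> real \<Rightarrow> real \<Rightarrow> bool" where
  "critical_point S \<alpha> \<beta> \<longleftrightarrow>
     \<alpha> > 0 \<and> \<beta> > 0 \<and>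
     deriv (\<lambda>x. step_poly S x \<beta>) \<alpha> = 0 \<and> deriv (\<lambda>y. step_poly S \<alpha> y) \<beta> = 0"

(* The quotient log \<alpha> / log \<beta> is taken in the extended reals: for \<beta> = 1 it is \<infinity>, -\<infinity> or 0
   according to whether \<alpha> > 1, \<alpha> < 1 or \<alpha> = 1. *)
definition log_ratio :: "real \<Rightarrow> real \<Rightarrow> ereal" where
  "log_ratio \<alpha> \<beta> = ereal (ln \<alpha>) / ereal (ln \<beta>)"

definition ereal_arctan :: "ereal \<Rightarrow> real" where
  "ereal_arctan r =
     (if r = \<infinity> then pi / 2 else if r = -\<infinity> then - (pi / 2) else arctan (real_of_ereal r))"

end

theory Submission
  imports Defs
begin

text \<open>
  Write \<open>f(u,v) = P(e\<^sup>u,e\<^sup>v)\<close>. If \<open>s \<ge> 0\<close>, a walk of length \<open>n\<close> in \<open>H\<^sub>\<theta>\<close> has weight at least 1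
  under the tilt \<open>(u,v) = s (sin \<theta>, cos \<theta>)\<close>, and all walks together weigh \<open>f(u,v)\<^sup>n\<close>, so
  \<open>K(\<theta>) \<le> f(u,v)\<close>. Conversely let \<open>(u,v)\<close> minimise \<open>f\<close> on the closed quadrant. Then the tilted
  drift is nonnegative, and zero in every coordinate that is tilted at all. By a Chernoff bound
  half of the weight \<open>f(u,v)\<^sup>n\<close> lies on walks which never go below \<open>-\<epsilon>n\<close> in either coordinate nor
  above \<open>\<epsilon>n\<close> in the tilted ones; such a walk has weight \<open>exp(O(\<epsilon>n))\<close> and stays in the
  quarter plane after a prefix of \<open>O(\<epsilon>n)\<close> steps pushing it into the interior. Hence
  \<open>K \<ge> f(u,v)\<close>, and with \<open>K \<le> K(\<theta>)\<close> all three quantities agree for \<open>\<theta>\<close> the direction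
  of \<open>(u,v)\<close>.

  A critical point of \<open>P\<close> is a global minimum \<open>(a,b)\<close> of the convex function \<open>f\<close>. If \<open>a, b \<ge> 0\<close>
  it is the minimum on the quadrant; if \<open>a, b \<le> 0\<close> the drift at the origin is nonnegative, because
  the steps are small, which makes every \<open>\<theta>\<close> optimal; if the signs differ, the segment from a minimum on the quadrant to
  \<open>(a,b)\<close> meets the boundary of the quadrant in another minimum. The models without a walk into
  the interior are those in which quarter-plane walks cannot leave a coordinate axis.
\<close>

section \<open>Exponential tilting\<close>

definition words :: "step set \<Rightarrow> nat \<Rightarrow> step list set" where
  "words S n = {w. set w \<subseteq> S \<and> length w = n}"

definition tilt :: "real \<Rightarrow> real \<Rightarrow> step \<Rightarrow> real" where
  "tilt u v s = exp (u * of_int (fst s) + v * of_int (snd s))"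

text \<open>This is P(e^u, e^v). In these logarithmic coordinates the step polynomial becomes
  jointly convex.\<close>

definition step_mgf :: "step set \<Rightarrow> real \<Rightarrow> real \<Rightarrow> real" where
  "step_mgf S u v = (\<Sum>s\<in>S. tilt u v s)"

text \<open>The gradient of \<open>step_mgf\<close> at (u, v). It is left unnormalised: the mean
  step of the tilted distribution is this vector divided by \<open>step_mgf S u v\<close>, and only
  signs and zeros of the components matter.\<close>

definition drift :: "step set \<Rightarrow> real \<Rightarrow> real \<Rightarrow> real \<times> real" where
  "drift S u v =
     (\<Sum>s\<in>S. of_int (fst s) * tilt u v s, \<Sum>s\<in>S. of_int (snd s) * tilt u v s)"

lemma tilt_pos [simp]: "0 < tilt u v s"
  by (simp add: tilt_def)

lemma tilt_zero [simp]: "tilt u v 0 = 1" "tilt 0 0 s = 1"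
  by (simp_all add: tilt_def)

lemma tilt_add: "tilt u v (s + t) = tilt u v s * tilt u v t"
  by (simp add: tilt_def algebra_simps flip: exp_add)

lemma tilt_tilt: "tilt u v s * tilt p q s = tilt (u + p) (v + q) s"
  by (simp add: tilt_def algebra_simps flip: exp_add)

lemma step_mgf_nonneg [simp]: "0 \<le> step_mgf S u v"
  by (simp add: step_mgf_def sum_nonneg less_imp_le)

lemma finite_words [simp]: "finite S \<Longrightarrow> finite (words S n)"
  by (simp add: words_def finite_lists_length_eq)

lemma words_0 [simp]: "words S 0 = {[]}"
  by (auto simp: words_def)

lemma words_Suc: "words S (Suc n) = (\<lambda>(s, w). s # w) ` (S \<times> words S n)"
  by (auto simp: words_def length_Suc_conv image_iff)

lemma sum_words_Suc:
  "(\<Sum>w\<in>words S (Suc n). h w) = (\<Sum>s\<in>S. \<Sum>w\<in>words S n. h (s # w))"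
proof -
  have "inj_on (\<lambda>(s, w). s # w) (S \<times> words S n)"
    by (auto simp: inj_on_def)
  then show ?thesis
    by (simp add: words_Suc sum.reindex sum.cartesian_product case_prod_unfold)
qed

text \<open>Weights multiply along a word, so the sum factorises letter by letter; the first j
  letters carry the additional tilt (p, q). Up to normalisation this is the moment generating
  function of a prefix sum under the tilted measure.\<close>

lemma sum_words_tilt_take:
  assumes "j \<le> n"
  shows "(\<Sum>w\<in>words S n. tilt u v (sum_list w) * tilt p q (sum_list (take j w)))
    = step_mgf S (u + p) (v + q) ^ j * step_mgf S u v ^ (n - j)"
  using assms
proof (induction n arbitrary: j)
  case 0
  then show ?case by simp
next
  case (Suc n)
  show ?case
  proof (cases j)
    case 0
    have "(\<Sum>w\<in>words S (Suc n). tilt u v (sum_list w))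
      = (\<Sum>s\<in>S. tilt u v s * (\<Sum>w\<in>words S n. tilt u v (sum_list w)))"
      by (simp add: sum_words_Suc tilt_add sum_distrib_left)
    then show ?thesis
      using Suc.IH[of 0] 0 by (simp add: step_mgf_def sum_distrib_right)
  next
    case (Suc k)
    have "(\<Sum>w\<in>words S (Suc n). tilt u v (sum_list w) * tilt p q (sum_list (take j w)))
      = (\<Sum>s\<in>S. tilt (u + p) (v + q) s *
          (\<Sum>w\<in>words S n. tilt u v (sum_list w) * tilt p q (sum_list (take k w))))"
      by (simp add: Suc sum_words_Suc tilt_add sum_distrib_left mult_ac flip: tilt_tilt)
    also have "\<dots> = step_mgf S (u + p) (v + q) * (step_mgf S (u + p) (v + q) ^ k * step_mgf S u v ^ (n - k))"
      using Suc.IH[of k] Suc.prems Suc by (simp add: step_mgf_def flip: sum_distrib_right)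
    finally show ?thesis
      using Suc by simp
  qed
qed

lemma sum_words_tilt: "(\<Sum>w\<in>words S n. tilt u v (sum_list w)) = step_mgf S u v ^ n"
  using sum_words_tilt_take[where j = 0 and p = 0 and q = 0] by simp

section \<open>A Chernoff bound for prefix sums of tilted words\<close>

lemma exp_le_quadratic:
  fixes x :: real
  assumes "\<bar>x\<bar> \<le> 1"
  shows "exp x \<le> 1 + x + x\<^sup>2"
proof (cases "x \<ge> 0")
  case True
  then show ?thesis using assms by (intro exp_bound) auto
next
  case False
  \<comment> \<open>For negative x both sides are multiplied by 1 - x > 0; the quadratic then
    telescopes to 1 - x^3, which is at least 1.\<close>
  have "exp x * (1 - x) \<le> exp x * exp (- x)"
    using exp_ge_add_one_self[of "- x"] by (intro mult_left_mono) auto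
  also have "\<dots> = 1" by (simp flip: exp_add)
  also have "\<dots> \<le> 1 - x ^ 3"
    using False by (simp add: power3_eq_cube mult_nonneg_nonpos mult_nonpos_nonpos zero_le_mult_iff mult_le_0_iff)
  also have "\<dots> = (1 + x + x\<^sup>2) * (1 - x)" by (simp add: algebra_simps power2_eq_square power3_eq_cube)
  finally show ?thesis using False by simp
qed

abbreviation (input) small_steps :: "step set" where
  "small_steps \<equiv> {-1, 0, 1} \<times> {-1, 0, 1}"

abbreviation proj :: "real \<times> real \<Rightarrow> step \<Rightarrow> real" where
  "proj d s \<equiv> fst d * of_int (fst s) + snd d * of_int (snd s)"

lemma abs_proj_le:
  assumes "s \<in> small_steps" "\<bar>fst d\<bar> + \<bar>snd d\<bar> \<le> 1"
  shows "\<bar>proj d s\<bar> \<le> 1"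
proof -
  have "\<bar>fst d * of_int (fst s)\<bar> \<le> \<bar>fst d\<bar>" "\<bar>snd d * of_int (snd s)\<bar> \<le> \<bar>snd d\<bar>"
    using assms(1) by auto
  then show ?thesis using assms(2) by linarith
qed

text \<open>Second-order expansion along d: the linear term is t times the inner product of d with
  the drift, hence not positive, and the rest is at most 1 + t^2. The bound on d keeps every
  exponent in [-1, 1], where \<open>exp_le_quadratic\<close> applies.\<close>

lemma step_mgf_shift_le:
  assumes S: "S \<subseteq> small_steps" and d: "\<bar>fst d\<bar> + \<bar>snd d\<bar> \<le> 1"
    and drift: "fst d * fst (drift S u v) + snd d * snd (drift S u v) \<le> 0"
    and t: "0 \<le> t" "t \<le> 1"
  shows "step_mgf S (u + t * fst d) (v + t * snd d) \<le> step_mgf S u v * exp (t\<^sup>2)"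
proof -
  have "tilt (u + t * fst d) (v + t * snd d) s
      \<le> (1 + t\<^sup>2) * tilt u v s + t * (proj d s * tilt u v s)" if "s \<in> S" for s
  proof -
    have p: "\<bar>proj d s\<bar> \<le> 1" using abs_proj_le d S that by blast
    have "\<bar>t * proj d s\<bar> \<le> 1"
      using p t by (simp add: abs_mult mult_le_one)
    then have "exp (t * proj d s) \<le> 1 + t * proj d s + (t * proj d s)\<^sup>2"
      by (rule exp_le_quadratic)
    also have "(t * proj d s)\<^sup>2 \<le> t\<^sup>2"
    proof -
      have "(proj d s)\<^sup>2 \<le> 1" using p by (simp add: abs_square_le_1)
      then have "t\<^sup>2 * (proj d s)\<^sup>2 \<le> t\<^sup>2 * 1" by (intro mult_left_mono) auto
      then show ?thesis by (simp add: power_mult_distrib)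
    qed
    finally have "tilt u v s * exp (t * proj d s) \<le> tilt u v s * (1 + t * proj d s + t\<^sup>2)"
      by (intro mult_left_mono) (auto simp: less_imp_le)
    moreover have "tilt (u + t * fst d) (v + t * snd d) s = tilt u v s * exp (t * proj d s)"
      by (simp add: tilt_def algebra_simps flip: exp_add)
    ultimately show ?thesis by (simp add: algebra_simps)
  qed
  then have "step_mgf S (u + t * fst d) (v + t * snd d)
      \<le> (\<Sum>s\<in>S. (1 + t\<^sup>2) * tilt u v s + t * (proj d s * tilt u v s))"
    unfolding step_mgf_def by (rule sum_mono)
  also have "\<dots> = (1 + t\<^sup>2) * step_mgf S u v
      + t * (fst d * fst (drift S u v) + snd d * snd (drift S u v))"
    by (simp add: step_mgf_def drift_def sum.distrib sum_distrib_left sum_distrib_right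
      distrib_left distrib_right mult_ac)
  also have "\<dots> \<le> (1 + t\<^sup>2) * step_mgf S u v"
    using drift t by (simp add: mult_nonneg_nonpos)
  also have "\<dots> \<le> exp (t\<^sup>2) * step_mgf S u v"
    by (intro mult_right_mono) auto
  finally show ?thesis by (simp add: mult.commute)
qed

text \<open>In a direction against or orthogonal to the drift, exceeding \<epsilon> n is
  exponentially unlikely: on this event the additional tilt by t in direction d, divided by exp(t
  \<epsilon> n), is at least 1.\<close>

lemma deviation_bound:
  assumes fin: "finite S" and S: "S \<subseteq> small_steps" and d: "\<bar>fst d\<bar> + \<bar>snd d\<bar> \<le> 1"
    and drift: "fst d * fst (drift S u v) + snd d * snd (drift S u v) \<le> 0"
    and \<epsilon>: "0 \<le> \<epsilon>" "\<epsilon> \<le> 1" and j: "j \<le> n"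
  shows "(\<Sum>w | w \<in> words S n \<and> \<epsilon> * n < proj d (sum_list (take j w)). tilt u v (sum_list w))
    \<le> step_mgf S u v ^ n * exp (- (\<epsilon>\<^sup>2 / 4) * n)"
proof -
  \<comment> \<open>This t minimises t^2 - t \<epsilon>, with minimum - \<epsilon>^2 / 4.\<close>
  define t where "t = \<epsilon> / 2"
  have t: "0 \<le> t" "t \<le> 1" using \<epsilon> by (auto simp: t_def)
  let ?s = "\<lambda>w. sum_list (take j w)"
  have "(\<Sum>w | w \<in> words S n \<and> \<epsilon> * n < proj d (?s w). tilt u v (sum_list w))
    \<le> (\<Sum>w | w \<in> words S n \<and> \<epsilon> * n < proj d (?s w).
          exp (- t * \<epsilon> * n) * (tilt u v (sum_list w) * tilt (t * fst d) (t * snd d) (?s w)))"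
  proof (rule sum_mono)
    fix w assume "w \<in> {w \<in> words S n. \<epsilon> * n < proj d (?s w)}"
    then have "t * (\<epsilon> * n) \<le> t * proj d (?s w)" using t by (intro mult_left_mono) auto
    then have "1 \<le> exp (t * proj d (?s w) - t * \<epsilon> * n)" by simp
    also have "\<dots> = exp (- t * \<epsilon> * n) * tilt (t * fst d) (t * snd d) (?s w)"
      by (simp add: tilt_def algebra_simps flip: exp_add)
    finally have "tilt u v (sum_list w) * 1
      \<le> tilt u v (sum_list w) * (exp (- t * \<epsilon> * n) * tilt (t * fst d) (t * snd d) (?s w))"
      by (intro mult_left_mono) (auto simp: less_imp_le)
    then show "tilt u v (sum_list w)
      \<le> exp (- t * \<epsilon> * n) * (tilt u v (sum_list w) * tilt (t * fst d) (t * snd d) (?s w))"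
      by (simp add: mult_ac)
  qed
  also have "\<dots> \<le> (\<Sum>w\<in>words S n.
      exp (- t * \<epsilon> * n) * (tilt u v (sum_list w) * tilt (t * fst d) (t * snd d) (?s w)))"
    using fin by (intro sum_mono2) (auto simp: less_imp_le)
  also have "\<dots> = exp (- t * \<epsilon> * n) *
      (step_mgf S (u + t * fst d) (v + t * snd d) ^ j * step_mgf S u v ^ (n - j))"
    by (simp add: sum_words_tilt_take[OF j] flip: sum_distrib_left)
  also have "\<dots> \<le> exp (- t * \<epsilon> * n) * ((step_mgf S u v * exp (t\<^sup>2)) ^ j * step_mgf S u v ^ (n - j))"
    by (intro mult_left_mono mult_right_mono power_mono step_mgf_shift_le[OF S d drift t]) auto
  also have "\<dots> = step_mgf S u v ^ n * exp (t\<^sup>2 * j - t * \<epsilon> * n)"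
  proof -
    have "step_mgf S u v ^ j * step_mgf S u v ^ (n - j) = step_mgf S u v ^ n"
      using j by (simp flip: power_add)
    then show ?thesis
      by (simp add: power_mult_distrib exp_diff exp_minus field_simps flip: exp_of_nat_mult)
  qed
  also have "\<dots> \<le> step_mgf S u v ^ n * exp (- (\<epsilon>\<^sup>2 / 4) * n)"
  proof -
    have "t\<^sup>2 * j \<le> t\<^sup>2 * n" using j by (intro mult_left_mono) auto
    then have "t\<^sup>2 * j - t * \<epsilon> * n \<le> - (\<epsilon>\<^sup>2 / 4) * n"
      by (simp add: t_def power2_eq_square algebra_simps)
    then show ?thesis by (intro mult_left_mono) auto
  qed
  finally show ?thesis .
qed

section \<open>Growth in the quarter plane from below\<close>

lemma sum_UN_le:
  fixes f :: "'a \<Rightarrow> real"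
  assumes "finite I" "\<And>i. i \<in> I \<Longrightarrow> finite (B i)" "\<And>x. 0 \<le> f x"
  shows "sum f (\<Union>i\<in>I. B i) \<le> (\<Sum>i\<in>I. sum f (B i))"
  using assms(1,2)
proof (induction I rule: finite_induct)
  case empty
  then show ?case by simp
next
  case (insert i I)
  have "sum f (B i \<union> (\<Union>i\<in>I. B i)) \<le> sum f (B i) + sum f (\<Union>i\<in>I. B i)"
    using insert by (subst sum.union_inter [symmetric]) (auto intro!: sum_nonneg assms(3))
  then show ?case using insert by fastforce
qed

text \<open>Only the lower bounds are recorded, since only they decide whether a shifted word stays
  in the quarter plane.\<close>

definition centred_words :: "step set \<Rightarrow> nat \<Rightarrow> real \<Rightarrow> step list set" where
  "centred_words S n r = {w \<in> words S n. \<forall>j\<le>n.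
     - r \<le> of_int (fst (sum_list (take j w))) \<and> - r \<le> of_int (snd (sum_list (take j w)))}"

text \<open>The hypotheses on the drift are the first-order conditions, with complementary
  slackness, for a minimum on the closed quadrant. At least half of the total weight survives the
  removal of deviating words, and dividing by the largest possible weight of a survivor turns this
  into a count.\<close>

lemma many_centred_words:
  assumes fin: "finite S" and S: "S \<subseteq> small_steps" and \<epsilon>: "0 < \<epsilon>" "\<epsilon> \<le> 1"
    and uv: "0 \<le> u" "0 \<le> v"
    and drift: "0 \<le> fst (drift S u v)" "0 \<le> snd (drift S u v)"
    and slack: "u * fst (drift S u v) = 0" "v * snd (drift S u v) = 0"
  shows "\<forall>\<^sub>F n in sequentially.
    step_mgf S u v ^ n * exp (- (u + v) * \<epsilon> * n) / 2 \<le> card (centred_words S n (\<epsilon> * n))"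
proof -
  define r where "r = exp (- (\<epsilon>\<^sup>2 / 4))"
  have r: "0 < r" "r < 1" using \<epsilon> by (auto simp: r_def)
  \<comment> \<open>The union bound runs over at most four directions and n + 1 prefix lengths, each
    event having relative weight at most r ^ n. Once the total is below 1/2, half of the weight
    remains.\<close>
  have "(\<lambda>n. 4 * (real n * r ^ n + r ^ n)) \<longlonglongrightarrow> 4 * (0 + 0)"
    using r by (intro tendsto_intros powser_times_n_limit_0 LIMSEQ_realpow_zero) auto
  then have "\<forall>\<^sub>F n in sequentially. 4 * (real n * r ^ n + r ^ n) < 1 / 2"
    by (rule order_tendstoD) auto
  then show ?thesis
  proof eventually_elim
    case (elim n)
    \<comment> \<open>The axis directions to which \<open>deviation_bound\<close> applies: both
      negative ones, and a positive one exactly when the drift vanishes in that coordinate.\<close>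
    define D :: "(real \<times> real) set" where "D = {d \<in> {(-1, 0), (0, -1), (1, 0), (0, 1)}.
      fst d * fst (drift S u v) + snd d * snd (drift S u v) \<le> 0}"
    have D: "D \<subseteq> {(-1, 0), (0, -1), (1, 0), (0, 1)}" by (auto simp: D_def)
    have finD: "finite D" using D by (rule finite_subset) auto
    have "card D \<le> card {(-1, 0), (0, -1), (1, 0), (0 :: real, 1 :: real)}"
      using D by (intro card_mono) auto
    also have "\<dots> \<le> 4" by (simp add: card_insert_if)
    finally have cardD: "card D \<le> 4" .
    define B where "B = (\<lambda>(d, j). {w. w \<in> words S n \<and> \<epsilon> * n < proj d (sum_list (take j w))})"
    define G where "G = words S n - (\<Union>i\<in>D \<times> {..n}. B i)"
    have finW: "finite (words S n)" using fin by simp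
    have B: "B i \<subseteq> words S n" for i by (auto simp: B_def split: prod.splits)
    let ?f = "\<lambda>w. tilt u v (sum_list w)"
    have "sum ?f (\<Union>i\<in>D \<times> {..n}. B i) \<le> (\<Sum>i\<in>D \<times> {..n}. sum ?f (B i))"
      using finD finite_subset[OF B finW] by (intro sum_UN_le) (auto simp: less_imp_le)
    also have "\<dots> \<le> (\<Sum>i\<in>D \<times> {..n}. step_mgf S u v ^ n * exp (- (\<epsilon>\<^sup>2 / 4) * n))"
    proof (rule sum_mono)
      fix i assume "i \<in> D \<times> {..n}"
      then obtain d j where i: "i = (d, j)" "d \<in> D" "j \<le> n" by auto
      show "sum ?f (B i) \<le> step_mgf S u v ^ n * exp (- (\<epsilon>\<^sup>2 / 4) * n)"
        unfolding i B_def prod.case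
      proof (rule deviation_bound[OF fin S])
        show "\<bar>fst d\<bar> + \<bar>snd d\<bar> \<le> 1" using i D by auto
        show "fst d * fst (drift S u v) + snd d * snd (drift S u v) \<le> 0"
          using i by (simp add: D_def)
      qed (use i \<epsilon> in simp_all)
    qed
    also have "\<dots> = (card D * (real n + 1)) * (step_mgf S u v ^ n * r ^ n)"
      by (simp add: r_def card_cartesian_product algebra_simps flip: exp_of_nat_mult)
    also have "\<dots> \<le> (4 * (real n + 1)) * (step_mgf S u v ^ n * r ^ n)"
      using cardD r by (intro mult_right_mono) auto
    also have "\<dots> = step_mgf S u v ^ n * (4 * (real n * r ^ n + r ^ n))"
      by (simp add: algebra_simps)
    also have "\<dots> \<le> step_mgf S u v ^ n * (1 / 2)"
      using elim by (intro mult_left_mono) auto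
    finally have bad: "sum ?f (\<Union>i\<in>D \<times> {..n}. B i) \<le> step_mgf S u v ^ n / 2" by simp
    have "sum ?f G = step_mgf S u v ^ n - sum ?f (\<Union>i\<in>D \<times> {..n}. B i)"
      unfolding G_def using B finW by (subst sum_diff) (auto simp: sum_words_tilt)
    with bad have good: "step_mgf S u v ^ n / 2 \<le> sum ?f G" by simp
    have Gle: "proj d (sum_list (take j w)) \<le> \<epsilon> * n" if "w \<in> G" "d \<in> D" "j \<le> n" for d j w
      using that by (force simp: G_def B_def)
    \<comment> \<open>By slackness a coordinate with positive tilt has zero drift, so its positive
      direction is in \<open>D\<close> and bounds the endpoint from above. An untilted coordinate
      does not enter the weight.\<close>
    have upper: "?f w \<le> exp ((u + v) * \<epsilon> * n)" if w: "w \<in> G" for w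
    proof -
      have "length w = n" using w by (auto simp: G_def words_def)
      have "u * of_int (fst (sum_list w)) \<le> u * (\<epsilon> * n)"
      proof (cases "u = 0")
        case False
        then have "(1, 0) \<in> D" using slack by (auto simp: D_def)
        from Gle[OF w this, of n] show ?thesis
          using uv \<open>length w = n\<close> by (intro mult_left_mono) auto
      qed auto
      moreover have "v * of_int (snd (sum_list w)) \<le> v * (\<epsilon> * n)"
      proof (cases "v = 0")
        case False
        then have "(0, 1) \<in> D" using slack by (auto simp: D_def)
        from Gle[OF w this, of n] show ?thesis
          using uv \<open>length w = n\<close> by (intro mult_left_mono) auto
      qed auto
      ultimately show ?thesis by (simp add: tilt_def algebra_simps)
    qed
    have "sum ?f G \<le> (\<Sum>w\<in>G. exp ((u + v) * \<epsilon> * n))"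
      by (rule sum_mono) (rule upper)
    also have "\<dots> = card G * exp ((u + v) * \<epsilon> * n)" by simp
    finally have cardG: "step_mgf S u v ^ n / 2 \<le> card G * exp ((u + v) * \<epsilon> * n)"
      using good by linarith
    have "(-1, 0) \<in> D" "(0, -1) \<in> D" using drift by (auto simp: D_def)
    then have "G \<subseteq> centred_words S n (\<epsilon> * n)"
      using Gle by (fastforce simp: centred_words_def G_def)
    then have "card G \<le> card (centred_words S n (\<epsilon> * n))"
      using finW by (intro card_mono) (auto simp: centred_words_def)
    then have "card G * exp ((u + v) * \<epsilon> * n)
      \<le> card (centred_words S n (\<epsilon> * n)) * exp ((u + v) * \<epsilon> * n)" by simp
    with cardG have "step_mgf S u v ^ n / 2
      \<le> card (centred_words S n (\<epsilon> * n)) * exp ((u + v) * \<epsilon> * n)" by linarith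
    then have "step_mgf S u v ^ n / 2 * exp (- ((u + v) * \<epsilon> * n))
      \<le> card (centred_words S n (\<epsilon> * n)) * exp ((u + v) * \<epsilon> * n) * exp (- ((u + v) * \<epsilon> * n))"
      by (intro mult_right_mono) simp_all
    also have "\<dots> = card (centred_words S n (\<epsilon> * n))"
      by (simp add: exp_minus)
    finally show ?case by (simp only: mult_minus_left times_divide_eq_left)
  qed
qed

section \<open>Making room for centred words by a prefix in the quarter plane\<close>

abbreviation in_quadrant :: "step \<Rightarrow> bool" where
  "in_quadrant s \<equiv> 0 \<le> fst s \<and> 0 \<le> snd s"

lemma walks_quarter_plane:
  "walks quarter_plane S n = {w \<in> words S n. \<forall>j\<le>n. in_quadrant (sum_list (take j w))}"
proof -
  have "(\<forall>j\<in>{1..n}. position w j \<in> quarter_plane)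
    \<longleftrightarrow> (\<forall>j\<le>n. in_quadrant (sum_list (take j w)))" for w
  proof -
    have "(\<forall>j\<le>n. in_quadrant (sum_list (take j w)))
      \<longleftrightarrow> (\<forall>j\<in>{1..n}. in_quadrant (sum_list (take j w)))"
      by (metis One_nat_def Suc_leI atLeastAtMost_iff fst_zero gr0I order_refl snd_zero
          sum_list.Nil take_0)
    then show ?thesis by (simp add: position_def quarter_plane_def real_point_def)
  qed
  then show ?thesis by (auto simp: walks_def words_def)
qed

lemma walks_quarter_plane_append:
  assumes "w \<in> walks quarter_plane S m" "w' \<in> words S n"
    and "\<And>j. j \<le> n \<Longrightarrow> in_quadrant (sum_list w + sum_list (take j w'))"
  shows "w @ w' \<in> walks quarter_plane S (m + n)"
proof -
  have len: "length w = m" and w: "\<And>j. j \<le> m \<Longrightarrow> in_quadrant (sum_list (take j w))"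
    using assms(1) by (auto simp: walks_quarter_plane words_def)
  have "in_quadrant (sum_list (take j (w @ w')))" if "j \<le> m + n" for j
  proof (cases "j \<le> m")
    case True
    then show ?thesis using w len by simp
  next
    case False
    then show ?thesis using assms(3)[of "j - m"] that len by simp
  qed
  moreover have "w @ w' \<in> words S (m + n)"
    using assms by (auto simp: walks_quarter_plane words_def)
  ultimately show ?thesis by (simp add: walks_quarter_plane)
qed

lemma walks_quarter_plane_repeat:
  assumes "g \<in> walks quarter_plane S L"
  shows "concat (replicate k g) \<in> walks quarter_plane S (k * L) \<and>
    fst (sum_list (concat (replicate k g))) = int k * fst (sum_list g) \<and>
    snd (sum_list (concat (replicate k g))) = int k * snd (sum_list g)"
proof (induction k)
  case 0
  then show ?case by (simp add: walks_quarter_plane)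
next
  case (Suc k)
  have "g @ concat (replicate k g) \<in> walks quarter_plane S (L + k * L)"
    using assms Suc
    by (intro walks_quarter_plane_append) (auto simp: walks_quarter_plane words_def)
  with Suc show ?case by (simp add: algebra_simps)
qed

text \<open>Repeating such a walk creates room in every coordinate that some step can decrease. The
  disjunctions also admit models confined to an axis, where the other coordinate needs no
  room.\<close>

definition pushing_walk :: "step set \<Rightarrow> step list \<Rightarrow> bool" where
  "pushing_walk S g \<longleftrightarrow> g \<noteq> [] \<and> g \<in> walks quarter_plane S (length g) \<and>
     (1 \<le> fst (sum_list g) \<or> (\<forall>s\<in>S. 0 \<le> fst s)) \<and>
     (1 \<le> snd (sum_list g) \<or> (\<forall>s\<in>S. 0 \<le> snd s))"

lemma sum_list_nonneg_fst: "\<forall>s\<in>set w. 0 \<le> fst s \<Longrightarrow> 0 \<le> fst (sum_list (w :: step list))"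
  by (induction w) auto

lemma sum_list_nonneg_snd: "\<forall>s\<in>set w. 0 \<le> snd s \<Longrightarrow> 0 \<le> snd (sum_list (w :: step list))"
  by (induction w) auto

text \<open>Prepending k copies of g is injective. It raises a coordinate by at least k \<ge> r if g
  moves in it; otherwise no step decreases that coordinate.\<close>

lemma card_centred_words_le:
  assumes fin: "finite S" and g: "pushing_walk S g" and r: "r \<le> real k"
  shows "card (centred_words S n r) \<le> card (walks quarter_plane S (k * length g + n))"
proof (rule card_inj_on_le)
  let ?p = "concat (replicate k g)"
  show "inj_on ((@) ?p) (centred_words S n r)" by (simp add: inj_on_def)
  show "finite (walks quarter_plane S (k * length g + n))"
    using fin by (simp add: walks_quarter_plane)
  have gw: "g \<in> walks quarter_plane S (length g)" using g by (simp add: pushing_walk_def)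
  note p = walks_quarter_plane_repeat[OF gw, of k]
  have gq: "in_quadrant (sum_list g)" using gw by (auto simp: walks_quarter_plane)
  show "(@) ?p ` centred_words S n r \<subseteq> walks quarter_plane S (k * length g + n)"
  proof clarify
    fix w assume w: "w \<in> centred_words S n r"
    show "?p @ w \<in> walks quarter_plane S (k * length g + n)"
    proof (rule walks_quarter_plane_append)
      fix j assume j: "j \<le> n"
      have sub: "set (take j w) \<subseteq> S"
        using w set_take_subset[of j w] by (auto simp: centred_words_def words_def)
      have lo: "- int k \<le> fst (sum_list (take j w))" "- int k \<le> snd (sum_list (take j w))"
        using w j r by (force simp: centred_words_def)+
      have "0 \<le> int k * fst (sum_list g) + fst (sum_list (take j w))"
      proof (cases "1 \<le> fst (sum_list g)")
        case True
        then have "int k * 1 \<le> int k * fst (sum_list g)" by (intro mult_left_mono) auto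
        with lo show ?thesis by linarith
      next
        case False
        then have "0 \<le> fst (sum_list (take j w))"
          using g sub by (intro sum_list_nonneg_fst) (auto simp: pushing_walk_def)
        with gq show ?thesis by simp
      qed
      moreover have "0 \<le> int k * snd (sum_list g) + snd (sum_list (take j w))"
      proof (cases "1 \<le> snd (sum_list g)")
        case True
        then have "int k * 1 \<le> int k * snd (sum_list g)" by (intro mult_left_mono) auto
        with lo show ?thesis by linarith
      next
        case False
        then have "0 \<le> snd (sum_list (take j w))"
          using g sub by (intro sum_list_nonneg_snd) (auto simp: pushing_walk_def)
        with gq show ?thesis by simp
      qed
      ultimately show "in_quadrant (sum_list ?p + sum_list (take j w))" using p by simp
    qed (use p w in \<open>auto simp: centred_words_def\<close>)
  qed
qed

lemma walk_tilt_le_step_mgf_power: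
  assumes "finite S" "w \<in> words S n"
  shows "tilt u v (sum_list w) \<le> step_mgf S u v ^ n"
  using member_le_sum[of w "words S n" "\<lambda>w. tilt u v (sum_list w)"] assms
  by (simp add: sum_words_tilt less_imp_le)

lemma pushing_walk_step_mgf_ge_1:
  assumes fin: "finite S" and g: "pushing_walk S g" and uv: "0 \<le> u" "0 \<le> v"
  shows "1 \<le> step_mgf S u v"
proof -
  have gw: "g \<in> words S (length g)" and "in_quadrant (sum_list g)" "g \<noteq> []"
    using g by (auto simp: pushing_walk_def walks_quarter_plane)
  then have "1 \<le> tilt u v (sum_list g)" using uv by (auto simp: tilt_def)
  also have "\<dots> \<le> step_mgf S u v ^ length g" by (rule walk_tilt_le_step_mgf_power[OF fin gw])
  finally have "\<not> step_mgf S u v ^ length g < 1" by simp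
  then show ?thesis
    using \<open>g \<noteq> []\<close> power_less_one_iff[of "step_mgf S u v" "length g"] by auto
qed

text \<open>If the growth were below some y < f, the count of centred words, extended by the pushing
  prefix, would be at most y ^ m for a length m only slightly larger than n. Comparing logarithms
  gives a contradiction for small \<epsilon> and large n.\<close>

lemma growth_quarter_plane_ge:
  assumes fin: "finite S" and S: "S \<subseteq> small_steps" and g: "pushing_walk S g"
    and uv: "0 \<le> u" "0 \<le> v"
    and drift: "0 \<le> fst (drift S u v)" "0 \<le> snd (drift S u v)"
    and slack: "u * fst (drift S u v) = 0" "v * snd (drift S u v) = 0"
  shows "ereal (step_mgf S u v) \<le> growth quarter_plane S"
proof (rule ccontr)
  define f where "f = step_mgf S u v"
  define q where "q = (\<lambda>n. card (walks quarter_plane S n))"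
  define L where "L = length g"
  have f1: "1 \<le> f" unfolding f_def by (rule pushing_walk_step_mgf_ge_1[OF fin g uv])
  assume "\<not> ?thesis"
  \<comment> \<open>The maximum with 0 makes y positive, so that its logarithm can be used.\<close>
  then have "max (growth quarter_plane S) 0 < ereal f" using f1 by (auto simp: f_def)
  then obtain y where y: "max (growth quarter_plane S) 0 < ereal y" "ereal y < ereal f"
    using ereal_dense2 by blast
  then have y0: "0 < y" "y < f" by auto
  have "limsup (\<lambda>n. ereal (root n (real (q n)))) < ereal y"
    using y unfolding growth_def q_def by simp
  then have "\<forall>\<^sub>F n in sequentially. ereal (root n (real (q n))) < ereal y"
    by (rule Limsup_lessD)
  then obtain N where N: "\<And>n. N \<le> n \<Longrightarrow> root n (real (q n)) < y"
    by (auto simp: eventually_sequentially)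
  define \<eta> where "\<eta> = ln f - ln y"
  have \<eta>: "0 < \<eta>" using y0 by (simp add: \<eta>_def)
  \<comment> \<open>The loss in the exponent per unit of \<epsilon> n: u + v from the weights of the
    centred words, and L ln f from the additional length of the prefix.\<close>
  define c where "c = u + v + L * ln f"
  have c: "0 \<le> c" using uv f1 by (simp add: c_def)
  \<comment> \<open>Chosen so that the loss \<epsilon> c takes at most half of the gap \<eta>; the
    summand 1 avoids a zero denominator.\<close>
  define \<epsilon> where "\<epsilon> = min 1 (\<eta> / (2 * (c + 1)))"
  have \<epsilon>: "0 < \<epsilon>" "\<epsilon> \<le> 1" using \<eta> c by (auto simp: \<epsilon>_def)
  have "\<epsilon> * c \<le> \<epsilon> * (c + 1)" using \<epsilon> by simp
  also have "\<dots> \<le> \<eta> / (2 * (c + 1)) * (c + 1)"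
    using c by (intro mult_right_mono) (auto simp: \<epsilon>_def)
  also have "\<dots> = \<eta> / 2" using c by (simp add: field_simps)
  finally have \<epsilon>c: "\<epsilon> * c \<le> \<eta> / 2" .
  have "\<forall>\<^sub>F n in sequentially. f ^ n * exp (- (u + v) * \<epsilon> * n) / 2
      \<le> card (centred_words S n (\<epsilon> * n))"
    unfolding f_def by (rule many_centred_words[OF fin S \<epsilon> uv drift slack])
  \<comment> \<open>The other half of the gap must absorb two constants: L ln f from rounding k up
    and ln 2 from keeping only half of the weight.\<close>
  moreover have "\<forall>\<^sub>F n in sequentially. 2 * (L * ln f + ln 2) / \<eta> \<le> real n"
    using filterlim_real_sequentially unfolding filterlim_at_top by blast
  ultimately have "\<forall>\<^sub>F n in sequentially. max 1 N \<le> n \<and> 2 * (L * ln f + ln 2) / \<eta> \<le> real n \<and>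
      f ^ n * exp (- (u + v) * \<epsilon> * n) / 2 \<le> card (centred_words S n (\<epsilon> * n))"
    using eventually_ge_at_top[of "max 1 N"] by eventually_elim auto
  then obtain n where n: "max 1 N \<le> n" "2 * (L * ln f + ln 2) / \<eta> \<le> real n"
      "f ^ n * exp (- (u + v) * \<epsilon> * n) / 2 \<le> card (centred_words S n (\<epsilon> * n))"
    using eventually_happens'[OF sequentially_bot] by blast
  define k where "k = nat \<lceil>\<epsilon> * n\<rceil>"
  have k: "\<epsilon> * n \<le> k" "k \<le> \<epsilon> * n + 1"
    using \<epsilon> ceiling_correct[of "\<epsilon> * n"] by (auto simp: k_def)
  define m where "m = k * L + n"
  have "n \<le> m" by (simp add: m_def)
  have "f ^ n * exp (- (u + v) * \<epsilon> * n) / 2 \<le> q m"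
    using n(3) card_centred_words_le[OF fin g k(1), of n] by (simp add: q_def m_def L_def)
  also have "q m < y ^ m"
  proof -
    have m: "0 < m" "N \<le> m" using n(1) \<open>n \<le> m\<close> by auto
    have "real (q m) = root m (q m) ^ m" using m by simp
    also have "\<dots> < y ^ m" using N[OF m(2)] m by (intro power_strict_mono) auto
    finally show ?thesis .
  qed
  finally have "ln (f ^ n * exp (- (u + v) * \<epsilon> * n) / 2) < ln (y ^ m)"
    using f1 y0 by (subst ln_less_cancel_iff) auto
  then have 1: "n * ln f + - (u + v) * \<epsilon> * n - ln 2 < m * ln y"
    using f1 y0 by (simp add: ln_mult ln_div ln_realpow)
  have "m * ln y = m * ln f - m * \<eta>" by (simp add: \<eta>_def algebra_simps)
  also have "\<dots> \<le> (n + L * (\<epsilon> * n + 1)) * ln f - n * \<eta>"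
  proof -
    have "L * real k \<le> L * (\<epsilon> * n + 1)" using k by (intro mult_left_mono) auto
    then have "m * ln f \<le> (n + L * (\<epsilon> * n + 1)) * ln f"
      using f1 by (intro mult_right_mono) (auto simp: m_def mult.commute)
    moreover have "n * \<eta> \<le> m * \<eta>" using \<eta> \<open>n \<le> m\<close> by simp
    ultimately show ?thesis by linarith
  qed
  finally have "n * \<eta> < n * (\<epsilon> * c) + L * ln f + ln 2"
    using 1 by (simp add: c_def algebra_simps)
  also have "n * (\<epsilon> * c) \<le> n * (\<eta> / 2)" using \<epsilon>c by (intro mult_left_mono) auto
  finally have "n * \<eta> / 2 < L * ln f + ln 2" by simp
  then have "n < 2 * (L * ln f + ln 2) / \<eta>" using \<eta> by (simp add: pos_less_divide_eq)
  with n(2) show False by simp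
qed

section \<open>Half planes and the minimum over the quadrant\<close>

lemma growth_mono:
  assumes "finite S" "\<And>n. walks R S' n \<subseteq> walks R' S n"
  shows "growth R S' \<le> growth R' S"
proof -
  have "card (walks R S' n) \<le> card (walks R' S n)" for n
  proof (rule card_mono[OF _ assms(2)])
    show "finite (walks R' S n)"
      using finite_words[OF assms(1), of n]
      by (rule rev_finite_subset) (auto simp: walks_def words_def)
  qed
  then show ?thesis
    unfolding growth_def
    by (intro Limsup_mono eventually_at_top_linorderI[of 1]) (auto intro!: real_root_le_mono)
qed

lemma walks_half_plane:
  "walks (half_plane \<theta>) S n =
     {w \<in> words S n. \<forall>j\<in>{1..n}. 0 \<le> proj (sin \<theta>, cos \<theta>) (sum_list (take j w))}"
  by (auto simp: walks_def words_def position_def real_point_def half_plane_def mult.commute)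

text \<open>Markov's inequality with the tilt along the inner normal of the half plane: a walk that
  ends in the half plane weighs at least 1.\<close>

lemma half_plane_growth_le_step_mgf:
  assumes "finite S" "0 \<le> s"
  shows "half_plane_growth S \<theta> \<le> ereal (step_mgf S (s * sin \<theta>) (s * cos \<theta>))"
  unfolding half_plane_growth_def growth_def
proof (rule Limsup_bounded, rule eventually_at_top_linorderI[of 1])
  fix n :: nat assume n: "1 \<le> n"
  let ?W = "walks (half_plane \<theta>) S n" and ?f = "step_mgf S (s * sin \<theta>) (s * cos \<theta>)"
  have W: "?W \<subseteq> words S n" by (auto simp: walks_half_plane)
  have "real (card ?W) = (\<Sum>w\<in>?W. 1)" by simp
  also have "\<dots> \<le> (\<Sum>w\<in>?W. tilt (s * sin \<theta>) (s * cos \<theta>) (sum_list w))"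
  proof (rule sum_mono)
    fix w assume w: "w \<in> ?W"
    then have "length w = n"
      and "\<forall>j\<in>{1..n}. 0 \<le> proj (sin \<theta>, cos \<theta>) (sum_list (take j w))"
      by (simp_all add: walks_half_plane words_def)
    from this(2)[rule_format, of n] n this(1)
    have "0 \<le> s * proj (sin \<theta>, cos \<theta>) (sum_list w)"
      using assms by (simp del: fst_conv snd_conv)
    then show "1 \<le> tilt (s * sin \<theta>) (s * cos \<theta>) (sum_list w)"
      by (simp add: tilt_def algebra_simps)
  qed
  also have "\<dots> \<le> (\<Sum>w\<in>words S n. tilt (s * sin \<theta>) (s * cos \<theta>) (sum_list w))"
    using W assms by (intro sum_mono2) (auto simp: less_imp_le)
  also have "\<dots> = ?f ^ n" by (rule sum_words_tilt)
  finally have "root n (real (card ?W)) \<le> root n (?f ^ n)"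
    using n by (intro real_root_le_mono) auto
  then show "ereal (root n (real (card ?W))) \<le> ereal ?f"
    using n by (simp add: real_root_power_cancel)
qed

lemma growth_quarter_plane_le_half_plane:
  assumes "finite S" "\<phi> \<in> {0..pi / 2}"
  shows "growth quarter_plane S \<le> half_plane_growth S \<phi>"
proof -
  have "quarter_plane \<subseteq> half_plane \<phi>"
    using assms(2) by (auto simp: quarter_plane_def half_plane_def sin_ge_zero cos_ge_zero)
  then show ?thesis
    unfolding half_plane_growth_def
    by (intro growth_mono assms) (auto simp: walks_def)
qed

section \<open>Existence and first-order conditions of a minimum on the quadrant\<close>

lemma continuous_on_step_mgf [continuous_intros]:
  "continuous_on A (\<lambda>p. step_mgf S (fst p) (snd p))"
  unfolding step_mgf_def tilt_def by (intro continuous_intros)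

text \<open>A word g ending in the open quadrant makes the function coercive there: its weight alone
  gives \<open>step_mgf S u v ^ L\<close> \<ge> exp(u + v). So a minimum over a large box is one
  over the quadrant.\<close>

lemma ex_min_step_mgf_quadrant:
  assumes fin: "finite S" and g: "g \<in> words S L" "g \<noteq> []"
    "1 \<le> fst (sum_list g)" "1 \<le> snd (sum_list g)"
  shows "\<exists>u v. 0 \<le> u \<and> 0 \<le> v \<and> (\<forall>u'\<ge>0. \<forall>v'\<ge>0. step_mgf S u v \<le> step_mgf S u' v')"
proof -
  have L: "0 < L" using g by (auto simp: words_def)
  \<comment> \<open>Outside the box u + v exceeds M, and exp(M) is already larger than
    \<open>step_mgf S 0 0 ^ L\<close>, so the origin does better.\<close>
  define M where "M = max 0 (ln (step_mgf S 0 0 ^ L + 1))"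
  let ?K = "{0..M} \<times> {0..M}"
  have "compact ?K" "?K \<noteq> {}" by (auto simp: compact_Times M_def)
  then obtain p where p: "p \<in> ?K" "\<And>p'. p' \<in> ?K \<Longrightarrow> step_mgf S (fst p) (snd p) \<le> step_mgf S (fst p') (snd p')"
    using continuous_attains_inf[OF _ _ continuous_on_step_mgf, of ?K S] by blast
  have "step_mgf S (fst p) (snd p) \<le> step_mgf S u v" if uv: "0 \<le> u" "0 \<le> v" for u v
  proof (cases "u \<le> M \<and> v \<le> M")
    case True
    then show ?thesis using p(2)[of "(u, v)"] uv by simp
  next
    case False
    have "step_mgf S 0 0 ^ L < step_mgf S 0 0 ^ L + 1" by simp
    also have "\<dots> = exp (ln (step_mgf S 0 0 ^ L + 1))"
      by (subst exp_ln) (auto intro: add_nonneg_pos)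
    also have "\<dots> \<le> exp (u + v)" using False uv by (auto simp: M_def)
    also have "\<dots> \<le> tilt u v (sum_list g)"
    proof -
      have "u * 1 \<le> u * of_int (fst (sum_list g))" "v * 1 \<le> v * of_int (snd (sum_list g))"
        using uv g by (intro mult_left_mono; simp)+
      then show ?thesis by (simp add: tilt_def)
    qed
    also have "\<dots> \<le> step_mgf S u v ^ L" by (rule walk_tilt_le_step_mgf_power[OF fin g(1)])
    finally have "step_mgf S 0 0 \<le> step_mgf S u v" using L power_less_imp_less_base by (force simp: less_imp_le)
    moreover have "step_mgf S (fst p) (snd p) \<le> step_mgf S 0 0" using p(2)[of "(0, 0)"] by (simp add: M_def)
    ultimately show ?thesis by simp
  qed
  then show ?thesis using p(1) by (intro exI[of _ "fst p"] exI[of _ "snd p"]) auto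
qed

lemma step_mgf_has_derivative_fst:
  "((\<lambda>x. step_mgf S x v) has_real_derivative fst (drift S u v)) (at u)"
  unfolding step_mgf_def drift_def tilt_def fst_conv
  by (auto intro!: derivative_eq_intros sum.cong)

lemma step_mgf_has_derivative_snd:
  "((\<lambda>y. step_mgf S u y) has_real_derivative snd (drift S u v)) (at v)"
  unfolding step_mgf_def drift_def tilt_def snd_conv
  by (auto intro!: derivative_eq_intros sum.cong)

lemma deriv_at_min_on_halfline:
  fixes h :: "real \<Rightarrow> real"
  assumes h: "(h has_real_derivative D) (at u)" and u: "0 \<le> u"
    and min: "\<And>x. 0 \<le> x \<Longrightarrow> h u \<le> h x"
  shows "0 \<le> D" "u * D = 0"
proof -
  show "0 \<le> D"
  proof (rule ccontr)
    assume "\<not> 0 \<le> D"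
    then obtain d where "d > 0" "\<And>x. 0 < x \<Longrightarrow> x < d \<Longrightarrow> h (u + x) < h u"
      using DERIV_neg_dec_right[OF h] by auto
    then have "h (u + d / 2) < h u" by simp
    with min[of "u + d / 2"] u \<open>d > 0\<close> show False by simp
  qed
  show "u * D = 0"
  proof (cases "u = 0")
    case False
    then have "D = 0" using u min by (intro DERIV_local_min[OF h, of u]) auto
    then show ?thesis by simp
  qed simp
qed

text \<open>The drift is the gradient, so the half-line conditions in each variable separately are
  the drift and slackness hypotheses of \<open>growth_quarter_plane_ge\<close>.\<close>

lemma growth_quarter_plane_ge_min:
  assumes fin: "finite S" and S: "S \<subseteq> small_steps" and g: "pushing_walk S g"
    and uv: "0 \<le> u" "0 \<le> v"
    and min: "\<And>u' v'. 0 \<le> u' \<Longrightarrow> 0 \<le> v' \<Longrightarrow> step_mgf S u v \<le> step_mgf S u' v'"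
  shows "ereal (step_mgf S u v) \<le> growth quarter_plane S"
  using deriv_at_min_on_halfline[OF step_mgf_has_derivative_fst uv(1)]
    deriv_at_min_on_halfline[OF step_mgf_has_derivative_snd uv(2)] uv min
  by (intro growth_quarter_plane_ge[OF fin S g]) blast+

text \<open>The angle is measured from the second axis, to agree with the normal (sin \<theta>, cos
  \<theta>) of \<open>half_plane\<close>.\<close>

lemma polar_quadrant:
  fixes u v :: real
  assumes "0 \<le> u" "0 \<le> v"
  obtains s \<theta> where "0 \<le> s" "\<theta> \<in> {0..pi / 2}" "u = s * sin \<theta>" "v = s * cos \<theta>"
proof (cases "u = 0 \<and> v = 0")
  case True
  then show ?thesis by (intro that[of 0 0]) auto
next
  case False
  define s where "s = sqrt (u\<^sup>2 + v\<^sup>2)"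
  have s: "0 < s" using False by (auto simp: s_def sum_power2_gt_zero_iff)
  have "(v / s)\<^sup>2 + (u / s)\<^sup>2 = (u\<^sup>2 + v\<^sup>2) / s\<^sup>2"
    by (simp add: power_divide add_divide_distrib)
  also have "\<dots> = 1" using False by (simp add: s_def sum_power2_eq_zero_iff)
  finally obtain t where "0 \<le> t" "t \<le> pi / 2" "v / s = cos t" "u / s = sin t"
    using sincos_total_pi_half[of "v / s" "u / s"] s assms by auto
  then show ?thesis using s by (intro that[of s t]) (auto simp: field_simps)
qed

text \<open>Termwise exp(x) \<ge> 1 + x. Its use is that a zero of the drift is a global
  minimum.\<close>

lemma step_mgf_ge_tangent:
  "step_mgf S a b + fst (drift S a b) * (u - a) + snd (drift S a b) * (v - b) \<le> step_mgf S u v"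
proof -
  have "tilt a b s * (1 + ((u - a) * of_int (fst s) + (v - b) * of_int (snd s))) \<le> tilt u v s" for s
  proof -
    have "tilt u v s = tilt a b s * exp ((u - a) * of_int (fst s) + (v - b) * of_int (snd s))"
      by (simp add: tilt_def algebra_simps flip: exp_add)
    then show ?thesis by (simp add: less_imp_le mult_left_mono)
  qed
  then have "(\<Sum>s\<in>S. tilt a b s * (1 + ((u - a) * of_int (fst s) + (v - b) * of_int (snd s)))) \<le> step_mgf S u v"
    unfolding step_mgf_def by (rule sum_mono)
  also have "(\<Sum>s\<in>S. tilt a b s * (1 + ((u - a) * of_int (fst s) + (v - b) * of_int (snd s))))
    = step_mgf S a b + fst (drift S a b) * (u - a) + snd (drift S a b) * (v - b)"
    by (simp add: step_mgf_def drift_def sum.distrib sum_distrib_left sum_distrib_right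
        distrib_left mult_ac)
  finally show ?thesis .
qed

lemma step_mgf_convex:
  assumes "0 \<le> t" "t \<le> 1"
  shows "step_mgf S ((1 - t) * u + t * a) ((1 - t) * v + t * b) \<le> (1 - t) * step_mgf S u v + t * step_mgf S a b"
proof -
  have "tilt ((1 - t) * u + t * a) ((1 - t) * v + t * b) s \<le> (1 - t) * tilt u v s + t * tilt a b s" for s
    using convex_onD[OF exp_convex assms, of "u * of_int (fst s) + v * of_int (snd s)"
        "a * of_int (fst s) + b * of_int (snd s)"]
    by (simp add: tilt_def algebra_simps)
  then have "step_mgf S ((1 - t) * u + t * a) ((1 - t) * v + t * b)
    \<le> (\<Sum>s\<in>S. (1 - t) * tilt u v s + t * tilt a b s)"
    unfolding step_mgf_def by (rule sum_mono)
  then show ?thesis by (simp add: step_mgf_def sum.distrib sum_distrib_left)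
qed

section \<open>Critical points of small-step models\<close>

lemma critical_point_drift:
  assumes "critical_point S \<alpha> \<beta>" and S: "S \<subseteq> small_steps"
  shows "drift S (ln \<alpha>) (ln \<beta>) = (0, 0)"
proof -
  have ab: "0 < \<alpha>" "0 < \<beta>" using assms by (auto simp: critical_point_def)
  have tilt: "tilt (ln \<alpha>) (ln \<beta>) s = \<alpha> powi fst s * \<beta> powi snd s" for s
    using ab exp_power_int[of "ln \<alpha>" "fst s"] exp_power_int[of "ln \<beta>" "snd s"]
    by (simp add: tilt_def exp_add mult.commute)
  have "((\<lambda>x. step_poly S x \<beta>) has_real_derivative
      (\<Sum>s\<in>S. of_int (fst s) * \<alpha> powi (fst s - 1) * \<beta> powi snd s)) (at \<alpha>)"
    unfolding step_poly_def case_prod_unfold using ab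
    by (auto intro!: derivative_eq_intros sum.cong)
  then have "(\<Sum>s\<in>S. of_int (fst s) * \<alpha> powi (fst s - 1) * \<beta> powi snd s) = 0"
    using assms(1) by (simp add: critical_point_def DERIV_imp_deriv)
  \<comment> \<open>Multiplication by \<alpha> turns the derivative in x into the derivative in u =
    ln x.\<close>
  then have "\<alpha> * (\<Sum>s\<in>S. of_int (fst s) * \<alpha> powi (fst s - 1) * \<beta> powi snd s) = 0" by simp
  then have 1: "fst (drift S (ln \<alpha>) (ln \<beta>)) = 0"
    using ab by (simp add: drift_def tilt sum_distrib_left power_int_diff mult_ac)
  have "((\<lambda>y. step_poly S \<alpha> y) has_real_derivative
      (\<Sum>s\<in>S. \<alpha> powi fst s * (of_int (snd s) * \<beta> powi (snd s - 1)))) (at \<beta>)"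
    unfolding step_poly_def case_prod_unfold using ab
    by (auto intro!: derivative_eq_intros sum.cong)
  then have "(\<Sum>s\<in>S. \<alpha> powi fst s * (of_int (snd s) * \<beta> powi (snd s - 1))) = 0"
    using assms(1) by (simp add: critical_point_def DERIV_imp_deriv)
  then have "\<beta> * (\<Sum>s\<in>S. \<alpha> powi fst s * (of_int (snd s) * \<beta> powi (snd s - 1))) = 0" by simp
  then have "snd (drift S (ln \<alpha>) (ln \<beta>)) = 0"
    using ab by (simp add: drift_def tilt sum_distrib_left power_int_diff mult_ac)
  with 1 show ?thesis by (simp add: prod_eq_iff)
qed

text \<open>The weights 1 \<ge> x \<ge> z favour \<open>d0\<close>, so a negative plain sum with a
  nonnegative weighted one forces \<open>d0 = 1\<close>; then \<open>d1 + d2 < -1\<close> leaves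
  only -1 for both.\<close>

lemma sign_pattern:
  fixes x z d0 d1 d2 :: real
  assumes d: "d0 \<in> {-1, 0, 1}" "d1 \<in> {-1, 0, 1}" "d2 \<in> {-1, 0, 1}"
    and x: "0 < z" "z \<le> x" "x \<le> 1"
    and h: "0 \<le> d0 + d1 * x + d2 * z" and neg: "d0 + d1 + d2 < 0"
  shows "d0 = 1 \<and> d1 = -1 \<and> d2 = -1"
  using d x h neg by (elim insertE emptyE) simp_all

text \<open>
  Here \<open>am, a0, a1\<close>, \<open>cm, c0, c1\<close> and \<open>l, r\<close> are the indicators of the steps
  \<open>(-1,1), (0,1), (1,1)\<close>, of \<open>(-1,-1), (0,-1), (1,-1)\<close>, and of \<open>(-1,0), (1,0)\<close>; the two
  equations are \<open>x y\<^sup>2 P\<^sub>y(x,y) = 0\<close> and \<open>x\<^sup>2 y P\<^sub>x(x,y) = 0\<close>. The lemma is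
  what makes \<open>\<theta>\<^sup>*\<close> optimal when \<open>log \<alpha>\<close> and \<open>log \<beta>\<close> are both negative.
\<close>

lemma small_step_critical_equations:
  fixes x y am a0 a1 cm c0 c1 l r :: real
  assumes ind: "am \<in> {0, 1}" "a0 \<in> {0, 1}" "a1 \<in> {0, 1}" "cm \<in> {0, 1}" "c0 \<in> {0, 1}" "c1 \<in> {0, 1}"
    "l \<in> {0, 1}" "r \<in> {0, 1}"
    and x: "0 < x" "x \<le> 1" and y: "0 < y" "y \<le> 1"
    and vert: "(am + a0 * x + a1 * x\<^sup>2) * y\<^sup>2 = cm + c0 * x + c1 * x\<^sup>2"
    and horiz: "(c1 + r * y + a1 * y\<^sup>2) * x\<^sup>2 = cm + l * y + am * y\<^sup>2"
  shows "cm + c0 + c1 \<le> am + a0 + a1"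
proof (rule ccontr)
  assume neg: "\<not> ?thesis"
  have y2: "y\<^sup>2 \<le> 1" using y by (simp add: power_le_one)
  have x2: "x\<^sup>2 \<le> x" "0 < x\<^sup>2" using x by (auto simp: power2_eq_square mult_left_le)
  have "0 \<le> am + a0 * x + a1 * x\<^sup>2"
    using ind(1-3) x by (intro add_nonneg_nonneg mult_nonneg_nonneg) (auto simp del: insert_iff elim!: insertE)
  \<comment> \<open>Since y^2 \<le> 1, omitting this factor turns the vertical equation into the
    weighted inequality of \<open>sign_pattern\<close>.\<close>
  with y2 have "(am + a0 * x + a1 * x\<^sup>2) * y\<^sup>2 \<le> am + a0 * x + a1 * x\<^sup>2"
    by (intro mult_left_le) auto
  then have "cm + c0 * x + c1 * x\<^sup>2 \<le> am + a0 * x + a1 * x\<^sup>2" using vert by simp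
  then have h: "0 \<le> (am - cm) + (a0 - c0) * x + (a1 - c1) * x\<^sup>2" by (simp add: algebra_simps)
  have bit: "p - q \<in> {-1, 0, 1} \<and> (p - q = 1 \<longrightarrow> p = 1 \<and> q = 0) \<and> (p - q = -1 \<longrightarrow> p = 0 \<and> q = 1)"
    if "p \<in> {0, 1}" "q \<in> {0, 1}" for p q :: real using that by auto
  note bits = bit[OF ind(1,4)] bit[OF ind(2,5)] bit[OF ind(3,6)]
  from bits have "am - cm \<in> {-1, 0, 1}" "a0 - c0 \<in> {-1, 0, 1}" "a1 - c1 \<in> {-1, 0, 1}"
    by blast+
  from sign_pattern[OF this x2(2,1) x(2) h] neg
  have "am - cm = 1" "a0 - c0 = -1" "a1 - c1 = -1" by simp_all
  with bits have "am = 1" "a0 = 0" "a1 = 0" "cm = 0" "c0 = 1" "c1 = 1" by blast+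
  \<comment> \<open>The one surviving pattern is excluded by the other equation: it gives y^2 \<le>
    2 x^2, whereas y^2 = x + x^2 > 2 x^2 because x < 1.\<close>
  then have v: "y\<^sup>2 = x + x\<^sup>2" and h: "(1 + r * y) * x\<^sup>2 = l * y + y\<^sup>2"
    using vert horiz by simp_all
  have "x < 1" using v y2 x2 by linarith
  then have "x\<^sup>2 < x" using x by (simp add: power2_eq_square)
  have "r * y \<le> 1" "0 \<le> l * y" using ind(7,8) y by auto
  then have "(1 + r * y) * x\<^sup>2 \<le> 2 * x\<^sup>2" by (intro mult_right_mono) auto
  then show False using v h \<open>x\<^sup>2 < x\<close> \<open>0 \<le> l * y\<close> by linarith
qed

lemma drift_small_steps:
  assumes S: "S \<subseteq> small_steps" and c: "c = (\<lambda>i j. of_bool ((i, j) \<in> S))"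
  shows "fst (drift S a b) = (c 1 (-1) * tilt a b (1, -1) + c 1 0 * tilt a b (1, 0) + c 1 1 * tilt a b (1, 1))
      - (c (-1) (-1) * tilt a b (-1, -1) + c (-1) 0 * tilt a b (-1, 0) + c (-1) 1 * tilt a b (-1, 1))" (is ?fst)
    and "snd (drift S a b) = (c (-1) 1 * tilt a b (-1, 1) + c 0 1 * tilt a b (0, 1) + c 1 1 * tilt a b (1, 1))
      - (c (-1) (-1) * tilt a b (-1, -1) + c 0 (-1) * tilt a b (0, -1) + c 1 (-1) * tilt a b (1, -1))" (is ?snd)
proof -
  have sum: "(\<Sum>s\<in>S. F s) =
      c (-1) (-1) * F (-1, -1) + c (-1) 0 * F (-1, 0) + c (-1) 1 * F (-1, 1)
    + c 0 (-1) * F (0, -1) + c 0 0 * F (0, 0) + c 0 1 * F (0, 1)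
    + c 1 (-1) * F (1, -1) + c 1 0 * F (1, 0) + c 1 1 * F (1, 1)" for F :: "step \<Rightarrow> real"
  proof -
    have "(\<Sum>s\<in>S. F s) = (\<Sum>s\<in>small_steps. c (fst s) (snd s) * F s)"
      using S by (intro sum.mono_neutral_cong_left) (auto simp: c)
    then show ?thesis by (simp flip: sum.cartesian_product')
  qed
  show ?fst ?snd
    unfolding drift_def fst_conv snd_conv sum by simp_all
qed

lemma drift_origin_nonneg:
  assumes S: "S \<subseteq> small_steps" and crit: "drift S a b = (0, 0)" and ab: "a \<le> 0" "b \<le> 0"
  shows "0 \<le> fst (drift S 0 0)" "0 \<le> snd (drift S 0 0)"
proof -
  define x where "x = exp a"
  define y where "y = exp b"
  define c :: "int \<Rightarrow> int \<Rightarrow> real" where "c = (\<lambda>i j. of_bool ((i, j) \<in> S))"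
  have x: "0 < x" "x \<le> 1" and y: "0 < y" "y \<le> 1" using ab by (auto simp: x_def y_def)
  have c: "c i j \<in> {0, 1}" for i j by (auto simp: c_def)
  have t: "tilt a b (1, 1) = x * y" "tilt a b (1, 0) = x" "tilt a b (1, -1) = x / y"
    "tilt a b (0, 1) = y" "tilt a b (0, -1) = 1 / y"
    "tilt a b (-1, 1) = y / x" "tilt a b (-1, 0) = 1 / x" "tilt a b (-1, -1) = 1 / (x * y)"
    by (simp_all add: tilt_def x_def y_def exp_add exp_diff exp_minus field_simps)
  note d = drift_small_steps[OF S c_def]
  have "(c 1 (-1) + c 1 0 * y + c 1 1 * y\<^sup>2) * x\<^sup>2
      - (c (-1) (-1) + c (-1) 0 * y + c (-1) 1 * y\<^sup>2) = x * y * fst (drift S a b)"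
    using x y by (simp add: d t field_simps power2_eq_square)
  then have h: "(c 1 (-1) + c 1 0 * y + c 1 1 * y\<^sup>2) * x\<^sup>2
      = c (-1) (-1) + c (-1) 0 * y + c (-1) 1 * y\<^sup>2"
    using crit by simp
  have "(c (-1) 1 + c 0 1 * x + c 1 1 * x\<^sup>2) * y\<^sup>2
      - (c (-1) (-1) + c 0 (-1) * x + c 1 (-1) * x\<^sup>2) = x * y * snd (drift S a b)"
    using x y by (simp add: d t field_simps power2_eq_square)
  then have v: "(c (-1) 1 + c 0 1 * x + c 1 1 * x\<^sup>2) * y\<^sup>2
      = c (-1) (-1) + c 0 (-1) * x + c 1 (-1) * x\<^sup>2"
    using crit by simp
  show "0 \<le> snd (drift S 0 0)"
    using small_step_critical_equations[OF c c c c c c c c x y v h] by (simp add: d)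
  \<comment> \<open>Reflection in the diagonal exchanges x with y and the two equations with each
    other.\<close>
  show "0 \<le> fst (drift S 0 0)"
    using small_step_critical_equations[OF c c c c c c c c y x h v] by (simp add: d)
qed

section \<open>From the logarithms of a critical point to an angle\<close>

lemma ereal_arctan_log_ratio:
  assumes "0 \<le> log_ratio \<alpha> \<beta>"
  defines "\<theta> \<equiv> ereal_arctan (log_ratio \<alpha> \<beta>)"
  shows "\<theta> \<in> {0..pi / 2}"
    and "(ln \<alpha> \<le> 0 \<and> ln \<beta> \<le> 0) \<or> (\<exists>s\<ge>0. ln \<alpha> = s * sin \<theta> \<and> ln \<beta> = s * cos \<theta>)"
proof -
  \<comment> \<open>The quotient determines the direction of (ln \<alpha>, ln \<beta>) only up to
    sign, hence the two alternatives.\<close>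
  have *: "\<theta> \<in> {0..pi / 2} \<and>
    ((ln \<alpha> \<le> 0 \<and> ln \<beta> \<le> 0) \<or> (\<exists>s\<ge>0. ln \<alpha> = s * sin \<theta> \<and> ln \<beta> = s * cos \<theta>))"
  proof (cases "ln \<beta> = 0")
    case True
    consider "ln \<alpha> > 0" | "ln \<alpha> = 0" | "ln \<alpha> < 0" by linarith
    then show ?thesis
    proof cases
      case 1
      then have "\<theta> = pi / 2"
        using True by (simp add: \<theta>_def log_ratio_def ereal_arctan_def divide_ereal_def)
      show ?thesis unfolding \<open>\<theta> = pi / 2\<close> using 1 True by (auto intro!: exI[of _ "ln \<alpha>"])
    next
      case 2
      then have "\<theta> = 0"
        using True by (simp add: \<theta>_def log_ratio_def ereal_arctan_def divide_ereal_def)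
      then show ?thesis using 2 True by auto
    next
      case 3
      then have "log_ratio \<alpha> \<beta> = - \<infinity>" using True by (simp add: log_ratio_def divide_ereal_def)
      with assms(1) show ?thesis by simp
    qed
  next
    case False
    then have r: "log_ratio \<alpha> \<beta> = ereal (ln \<alpha> / ln \<beta>)" by (simp add: log_ratio_def)
    then have \<theta>: "\<theta> = arctan (ln \<alpha> / ln \<beta>)" by (simp add: \<theta>_def ereal_arctan_def)
    have q: "0 \<le> ln \<alpha> / ln \<beta>" using assms(1) r by simp
    have "\<theta> \<in> {0..pi / 2}" using q arctan_ubound[of "ln \<alpha> / ln \<beta>"] by (simp add: \<theta>)
    moreover have "\<exists>s\<ge>0. ln \<alpha> = s * sin \<theta> \<and> ln \<beta> = s * cos \<theta>" if "ln \<beta> > 0"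
    proof (intro exI conjI)
      have cos: "0 < cos \<theta>" unfolding \<theta> cos_arctan by (simp add: add_pos_nonneg)
      have "tan \<theta> = ln \<alpha> / ln \<beta>" unfolding \<theta> by (rule tan_arctan)
      then show "ln \<alpha> = ln \<beta> / cos \<theta> * sin \<theta>" using False by (simp add: tan_def field_simps)
      show "0 \<le> ln \<beta> / cos \<theta>" "ln \<beta> = ln \<beta> / cos \<theta> * cos \<theta>" using that cos by auto
    qed
    moreover have "ln \<alpha> \<le> 0" if "ln \<beta> < 0" using q that by (simp add: zero_le_divide_iff)
    ultimately show ?thesis using False by fastforce
  qed
  from * show "\<theta> \<in> {0..pi / 2}" by simp
  from * show "(ln \<alpha> \<le> 0 \<and> ln \<beta> \<le> 0) \<or> (\<exists>s\<ge>0. ln \<alpha> = s * sin \<theta> \<and> ln \<beta> = s * cos \<theta>)" by simp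
qed

text \<open>The weak inequality for ln \<beta> covers the quotient -\<infinity>, which arises from
  ln \<beta> = 0 and ln \<alpha> < 0.\<close>

lemma log_ratio_neg:
  assumes "\<not> 0 \<le> log_ratio \<alpha> \<beta>"
  shows "ln \<alpha> < 0 \<and> 0 \<le> ln \<beta> \<or> 0 < ln \<alpha> \<and> ln \<beta> < 0"
proof (cases "ln \<beta> = 0")
  case True
  then show ?thesis
    using assms by (cases "ln \<alpha> = 0"; cases "0 < ln \<alpha>") (auto simp: log_ratio_def divide_ereal_def)
next
  case False
  then have "ln \<alpha> / ln \<beta> < 0" using assms by (simp add: log_ratio_def)
  then show ?thesis by (auto simp: divide_less_0_iff)
qed

text \<open>Every half-plane growth bounds the quarter-plane growth from above, so one reverse
  inequality gives both equality and minimality. The theorem is thereby reduced to such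
  inequalities.\<close>

lemma optimal_angle:
  assumes "finite S" "\<theta> \<in> {0..pi / 2}" "half_plane_growth S \<theta> \<le> growth quarter_plane S"
  shows "growth quarter_plane S = half_plane_growth S \<theta>"
    and "is_arg_min (half_plane_growth S) (\<lambda>\<theta>. \<theta> \<in> {0..pi / 2}) \<theta>"
  using growth_quarter_plane_le_half_plane[OF assms(1)] assms(2,3)
  by (force simp: is_arg_min_def intro: antisym)+

lemma half_plane_growth_le_if_trivial_tilt:
  assumes "finite S" "ereal (step_mgf S 0 0) \<le> growth quarter_plane S"
  shows "half_plane_growth S \<theta> \<le> growth quarter_plane S"
  using half_plane_growth_le_step_mgf[OF assms(1), of 0 \<theta>] assms(2) by simp

section \<open>Consequences of nontriviality\<close>

lemma walk_nonzero_step_in_quadrant: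
  assumes w: "w \<in> walks quarter_plane S n" and s: "s \<in> set w" "s \<noteq> 0"
  shows "\<exists>s\<in>S. s \<noteq> 0 \<and> in_quadrant s"
proof -
  \<comment> \<open>The first nonzero step starts at the origin, so the step itself lies in the
    quadrant.\<close>
  obtain ys t zs where split: "w = ys @ t # zs" "t \<noteq> 0" "\<forall>y\<in>set ys. \<not> y \<noteq> 0"
    using split_list_first_prop[of w "\<lambda>s. s \<noteq> 0"] s by blast
  have "sum_list ys = 0" using split(3) by (induction ys) auto
  moreover have "Suc (length ys) \<le> n" using w split(1) by (auto simp: walks_quarter_plane words_def)
  then have "in_quadrant (sum_list (take (Suc (length ys)) w))"
    using w by (auto simp: walks_quarter_plane)
  ultimately have "in_quadrant t" using split(1) by simp
  moreover have "t \<in> S" using w split(1) by (auto simp: walks_quarter_plane words_def)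
  ultimately show ?thesis using split(2) by blast
qed

text \<open>The point before the arrival is in the quadrant, so the arriving step is bounded
  componentwise by the point reached; on an axis this makes one component of the step
  nonpositive.\<close>

lemma touching_step:
  assumes w: "w \<in> walks quarter_plane S n" and t: "touches w B"
  obtains s j where "s \<in> S" "s \<in> set w" "s \<noteq> 0" "position w j \<in> B"
    "fst (sum_list (take j w)) \<ge> fst s" "snd (sum_list (take j w)) \<ge> snd s"
proof -
  obtain j where j: "j \<in> {1..length w}" "w ! (j - 1) \<noteq> (0, 0)" "position w j \<in> B"
    using t by (auto simp: touches_def)
  then obtain k where k: "j = Suc k" "k < length w" by (cases j) auto
  have "in_quadrant (sum_list (take k w))"
    using w k by (auto simp: walks_quarter_plane words_def)
  moreover have "sum_list (take j w) = sum_list (take k w) + w ! k"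
    using k by (simp add: take_Suc_conv_app_nth)
  moreover have "w ! k \<in> set w" using k by simp
  moreover have "w ! k \<in> S" using w k by (auto simp: walks_quarter_plane words_def)
  ultimately show ?thesis using j k by (intro that[of "w ! k" j]) (auto simp: zero_prod_def)
qed

lemma nontrivial_model_steps:
  assumes "nontrivial_model quarter_plane quarter_plane_boundaries S"
  shows "\<exists>s\<in>S. s \<noteq> 0 \<and> in_quadrant s"
    and "\<exists>w n s. w \<in> walks quarter_plane S n \<and> s \<in> set w \<and> s \<noteq> 0 \<and> fst s \<le> 0"
    and "\<exists>w n s. w \<in> walks quarter_plane S n \<and> s \<in> set w \<and> s \<noteq> 0 \<and> snd s \<le> 0"
proof -
  have "{(x, y). x = 0 \<and> 0 \<le> y} \<in> quarter_plane_boundaries"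
    unfolding quarter_plane_boundaries_def by blast
  then have "\<exists>n. \<exists>w\<in>walks quarter_plane S n. touches w {(x, y). x = 0 \<and> 0 \<le> y}"
    using assms by (simp only: nontrivial_model_def)
  then obtain w n where w: "w \<in> walks quarter_plane S n" "touches w {(x, y). x = 0 \<and> 0 \<le> y}" by blast
  obtain s j where s: "s \<in> S" "s \<in> set w" "s \<noteq> 0" "position w j \<in> {(x, y). x = 0 \<and> 0 \<le> y}"
    "fst (sum_list (take j w)) \<ge> fst s" "snd (sum_list (take j w)) \<ge> snd s"
    by (rule touching_step[OF w])
  then have "fst s \<le> 0" by (simp add: position_def real_point_def)
  with s w show "\<exists>w n s. w \<in> walks quarter_plane S n \<and> s \<in> set w \<and> s \<noteq> 0 \<and> fst s \<le> 0" by blast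
  show "\<exists>s\<in>S. s \<noteq> 0 \<and> in_quadrant s" using walk_nonzero_step_in_quadrant w(1) s(2,3) by blast
next
  have "{(x, y). 0 \<le> x \<and> y = 0} \<in> quarter_plane_boundaries"
    unfolding quarter_plane_boundaries_def by blast
  then have "\<exists>n. \<exists>w\<in>walks quarter_plane S n. touches w {(x, y). 0 \<le> x \<and> y = 0}"
    using assms by (simp only: nontrivial_model_def)
  then obtain w n where w: "w \<in> walks quarter_plane S n" "touches w {(x, y). 0 \<le> x \<and> y = 0}" by blast
  obtain s j where s: "s \<in> S" "s \<in> set w" "s \<noteq> 0" "position w j \<in> {(x, y). 0 \<le> x \<and> y = 0}"
    "fst (sum_list (take j w)) \<ge> fst s" "snd (sum_list (take j w)) \<ge> snd s"
    by (rule touching_step[OF w])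
  then have "snd s \<le> 0" by (simp add: position_def real_point_def)
  with s w show "\<exists>w n s. w \<in> walks quarter_plane S n \<and> s \<in> set w \<and> s \<noteq> 0 \<and> snd s \<le> 0" by blast
qed

section \<open>Models confined to the boundary line of a half plane\<close>

lemma sum_list_eq_0_imp_steps_eq_0:
  fixes f :: "'a \<Rightarrow> real"
  assumes "\<forall>s\<in>set w. f s \<le> 0" "0 \<le> sum_list (map f w)"
  shows "\<forall>s\<in>set w. f s = 0"
  using assms
proof (induction w)
  case (Cons s w)
  have "sum_list (map f w) \<le> 0" using Cons.prems(1) by (intro sum_list_nonpos) auto
  with Cons show ?case by auto
qed simp

lemma proj_sum_list: "proj d (sum_list w) = sum_list (map (proj d) w)"
  by (induction w) (auto simp: algebra_simps)

text \<open>If no step increases the inner product with the normal, a walk that keeps it nonnegative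
  can never decrease it either.\<close>

lemma walks_half_plane_flat:
  assumes "\<forall>s\<in>S. proj (sin \<theta>, cos \<theta>) s \<le> 0"
  shows "walks (half_plane \<theta>) S n \<subseteq> walks (half_plane \<theta>) {s \<in> S. proj (sin \<theta>, cos \<theta>) s = 0} n"
proof
  fix w assume w: "w \<in> walks (half_plane \<theta>) S n"
  let ?p = "proj (sin \<theta>, cos \<theta>)"
  have len: "length w = n" and S: "set w \<subseteq> S"
    and pos: "\<forall>j\<in>{1..n}. 0 \<le> ?p (sum_list (take j w))"
    using w by (simp_all add: walks_half_plane words_def)
  have "0 \<le> ?p (sum_list w)"
  proof (cases "n = 0")
    case False
    then show ?thesis using pos[rule_format, of n] len by simp
  qed (use len in simp)
  then have "0 \<le> sum_list (map ?p w)" by (simp only: proj_sum_list)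
  moreover have "\<forall>s\<in>set w. ?p s \<le> 0" using assms S by blast
  ultimately have "\<forall>s\<in>set w. ?p s = 0" by (intro sum_list_eq_0_imp_steps_eq_0)
  with S have "set w \<subseteq> {s \<in> S. ?p s = 0}" by blast
  with w show "w \<in> walks (half_plane \<theta>) {s \<in> S. ?p s = 0} n"
    by (simp add: walks_half_plane words_def)
qed

text \<open>Half-plane walks use only the steps in \<open>S0\<close>. That submodel has zero drift
  at the origin, so its half-plane growth is at most its quarter-plane growth, which the full model
  dominates.\<close>

lemma half_plane_growth_flat_le:
  assumes fin: "finite S" and S: "S \<subseteq> small_steps" and flat: "\<forall>s\<in>S. proj (sin \<theta>, cos \<theta>) s \<le> 0"
  defines "S0 \<equiv> {s \<in> S. proj (sin \<theta>, cos \<theta>) s = 0}"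
  assumes g: "pushing_walk S0 g" and drift: "drift S0 0 0 = (0, 0)"
  shows "half_plane_growth S \<theta> \<le> growth quarter_plane S"
proof -
  have S0: "finite S0" "S0 \<subseteq> small_steps" "S0 \<subseteq> S" using fin S by (auto simp: S0_def)
  have "half_plane_growth S \<theta> \<le> half_plane_growth S0 \<theta>"
    unfolding half_plane_growth_def
    using walks_half_plane_flat[OF flat] S0(1) by (intro growth_mono) (auto simp: S0_def)
  also have "\<dots> \<le> growth quarter_plane S0"
    using drift by (intro half_plane_growth_le_if_trivial_tilt S0 growth_quarter_plane_ge[OF S0(1,2) g]) auto
  also have "\<dots> \<le> growth quarter_plane S"
    using S0(3) fin by (intro growth_mono) (auto simp: walks_def)
  finally show ?thesis .
qed

lemma nontrivial_model_cases:
  assumes S: "S \<subseteq> small_steps" and nt: "nontrivial_model quarter_plane quarter_plane_boundaries S"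
  obtains (full) g where "pushing_walk S g" "1 \<le> fst (sum_list g)" "1 \<le> snd (sum_list g)"
  | (horizontal) "\<forall>s\<in>S. snd s \<le> 0" "(1, 0) \<in> S" "(-1, 0) \<in> S"
  | (vertical) "\<forall>s\<in>S. fst s \<le> 0" "(0, 1) \<in> S" "(0, -1) \<in> S"
proof -
  have push: thesis if "set g \<subseteq> S" "\<forall>j\<le>length g. in_quadrant (sum_list (take j g))"
    "1 \<le> fst (sum_list g)" "1 \<le> snd (sum_list g)" for g
    using that by (intro full[of g]) (auto simp: pushing_walk_def walks_quarter_plane words_def)
  obtain s where s: "s \<in> S" "s \<noteq> 0" "in_quadrant s" using nontrivial_model_steps(1)[OF nt] by blast
  then have "s \<in> {(1, 1), (1, 0), (0, 1)}" using S by (auto simp: zero_prod_def)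
  \<comment> \<open>Without (1, 1), a nonzero step in the quadrant lies on an axis, and the question
    is whether some step raises the other coordinate.\<close>
  then consider "(1, 1) \<in> S" | "(1, 0) \<in> S" "(0, 1) \<in> S" | "(1, 0) \<in> S" "(-1, 1) \<in> S"
    | "(0, 1) \<in> S" "(1, -1) \<in> S"
    | "(1, 0) \<in> S" "(1, 1) \<notin> S" "(0, 1) \<notin> S" "(-1, 1) \<notin> S"
    | "(0, 1) \<in> S" "(1, 1) \<notin> S" "(1, 0) \<notin> S" "(1, -1) \<notin> S"
    using s(1) by auto
  then show thesis
  proof cases
    case 1
    then show ?thesis by (intro push[of "[(1, 1)]"]) (auto simp: le_Suc_eq)
  next
    case 2
    then show ?thesis by (intro push[of "[(1, 0), (0, 1)]"]) (auto simp: le_Suc_eq)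
  next
    case 3
    \<comment> \<open>Two steps to the right, so that the first coordinate is still 1 after the step
      back.\<close>
    then show ?thesis by (intro push[of "[(1, 0), (1, 0), (-1, 1)]"]) (auto simp: le_Suc_eq)
  next
    case 4
    then show ?thesis by (intro push[of "[(0, 1), (0, 1), (1, -1)]"]) (auto simp: le_Suc_eq)
  next
    case 5
    have low: "\<forall>s\<in>S. snd s \<le> 0"
    proof
      fix s assume s: "s \<in> S"
      with 5 have "s \<noteq> (1, 1)" "s \<noteq> (0, 1)" "s \<noteq> (-1, 1)" by auto
      moreover have "s \<in> small_steps" using s S by blast
      ultimately show "snd s \<le> 0" by auto
    qed
    obtain w n s where w: "w \<in> walks quarter_plane S n" "s \<in> set w" "s \<noteq> 0" "fst s \<le> 0"
      using nontrivial_model_steps(2)[OF nt] by blast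
    \<comment> \<open>Without upward steps a quarter-plane walk stays on the horizontal axis, so the
      nonzero step with \<open>fst s \<le> 0\<close> can only be (-1, 0).\<close>
    have "quarter_plane \<subseteq> half_plane 0" by (auto simp: quarter_plane_def half_plane_def)
    then have "w \<in> walks (half_plane 0) S n" using w(1) by (auto simp: walks_def)
    moreover have "\<forall>s\<in>S. proj (sin 0, cos 0) s \<le> 0" using low by simp
    ultimately have "w \<in> walks (half_plane 0) {s \<in> S. proj (sin 0, cos 0) s = 0} n"
      using walks_half_plane_flat by blast
    then have s: "snd s = 0" "s \<in> S" using w(2) by (auto simp: walks_def)
    then have "s \<in> small_steps" using S by blast
    with s w(3,4) have "s = (-1, 0)" by (auto simp: zero_prod_def)
    with \<open>s \<in> S\<close> low 5 show ?thesis by (intro horizontal) auto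
  next
    case 6
    have low: "\<forall>s\<in>S. fst s \<le> 0"
    proof
      fix s assume s: "s \<in> S"
      with 6 have "s \<noteq> (1, 1)" "s \<noteq> (1, 0)" "s \<noteq> (1, -1)" by auto
      moreover have "s \<in> small_steps" using s S by blast
      ultimately show "fst s \<le> 0" by auto
    qed
    obtain w n s where w: "w \<in> walks quarter_plane S n" "s \<in> set w" "s \<noteq> 0" "snd s \<le> 0"
      using nontrivial_model_steps(3)[OF nt] by blast
    have "quarter_plane \<subseteq> half_plane (pi / 2)" by (auto simp: quarter_plane_def half_plane_def)
    then have "w \<in> walks (half_plane (pi / 2)) S n" using w(1) by (auto simp: walks_def)
    moreover have "\<forall>s\<in>S. proj (sin (pi / 2), cos (pi / 2)) s \<le> 0" using low by simp
    ultimately have "w \<in> walks (half_plane (pi / 2)) {s \<in> S. proj (sin (pi / 2), cos (pi / 2)) s = 0} n"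
      using walks_half_plane_flat by blast
    then have s: "fst s = 0" "s \<in> S" using w(2) by (auto simp: walks_def)
    then have "s \<in> small_steps" using S by blast
    with s w(3,4) have "s = (0, -1)" by (auto simp: zero_prod_def)
    with \<open>s \<in> S\<close> low 6 show ?thesis by (intro vertical) auto
  qed
qed

section \<open>Optimality of the predicted angles\<close>

lemma half_plane_growth_le_if_min:
  assumes fin: "finite S" and S: "S \<subseteq> small_steps" and g: "pushing_walk S g"
    and s: "0 \<le> s" and \<theta>: "\<theta> \<in> {0..pi / 2}"
    and min: "\<And>u v. 0 \<le> u \<Longrightarrow> 0 \<le> v \<Longrightarrow> step_mgf S (s * sin \<theta>) (s * cos \<theta>) \<le> step_mgf S u v"
  shows "half_plane_growth S \<theta> \<le> growth quarter_plane S"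
proof -
  have "0 \<le> s * sin \<theta>" "0 \<le> s * cos \<theta>"
    using s \<theta> by (auto intro!: mult_nonneg_nonneg sin_ge_zero cos_ge_zero)
  then have "ereal (step_mgf S (s * sin \<theta>) (s * cos \<theta>)) \<le> growth quarter_plane S"
    by (intro growth_quarter_plane_ge_min[OF fin S g] min)
  with half_plane_growth_le_step_mgf[OF fin s] show ?thesis by (rule order_trans)
qed

lemma half_plane_growth_le_if_critical:
  assumes fin: "finite S" and S: "S \<subseteq> small_steps" and g: "pushing_walk S g"
    and g1: "1 \<le> fst (sum_list g)" "1 \<le> snd (sum_list g)"
    and crit: "drift S (ln \<alpha>) (ln \<beta>) = (0, 0)"
  shows "if log_ratio \<alpha> \<beta> \<ge> 0
    then half_plane_growth S (ereal_arctan (log_ratio \<alpha> \<beta>)) \<le> growth quarter_plane S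
    else half_plane_growth S 0 \<le> growth quarter_plane S
      \<or> half_plane_growth S (pi / 2) \<le> growth quarter_plane S"
proof (cases "log_ratio \<alpha> \<beta> \<ge> 0")
  case True
  let ?\<theta> = "ereal_arctan (log_ratio \<alpha> \<beta>)"
  have glob: "step_mgf S (ln \<alpha>) (ln \<beta>) \<le> step_mgf S u v" for u v
    using step_mgf_ge_tangent[of S "ln \<alpha>" "ln \<beta>" u v] crit by simp
  from ereal_arctan_log_ratio(2)[OF True] show ?thesis
  proof (elim disjE exE conjE)
    assume "ln \<alpha> \<le> 0" "ln \<beta> \<le> 0"
    then have "ereal (step_mgf S 0 0) \<le> growth quarter_plane S"
      using drift_origin_nonneg[OF S crit] by (intro growth_quarter_plane_ge[OF fin S g]) auto
    then show ?thesis using True half_plane_growth_le_if_trivial_tilt[OF fin] by simp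
  next
    fix s assume "0 \<le> s" "ln \<alpha> = s * sin ?\<theta>" "ln \<beta> = s * cos ?\<theta>"
    then show ?thesis
      using True glob ereal_arctan_log_ratio(1)[OF True]
        half_plane_growth_le_if_min[OF fin S g, of s ?\<theta>] by simp
  qed
next
  case False
  define a where "a = ln \<alpha>"
  define b where "b = ln \<beta>"
  have glob: "step_mgf S a b \<le> step_mgf S u v" for u v
    using step_mgf_ge_tangent[of S a b u v] crit by (simp add: a_def b_def)
  obtain u v where uv: "0 \<le> u" "0 \<le> v"
    and min: "\<And>u' v'. 0 \<le> u' \<Longrightarrow> 0 \<le> v' \<Longrightarrow> step_mgf S u v \<le> step_mgf S u' v'"
  proof -
    have "g \<in> words S (length g)" "g \<noteq> []" using g by (auto simp: pushing_walk_def walks_quarter_plane)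
    from ex_min_step_mgf_quadrant[OF fin this g1] that show thesis by blast
  qed
  \<comment> \<open>By convexity, no point of the segment from the quadrant minimum (u, v) to the
    global minimum (a, b) has a larger value than (u, v).\<close>
  have seg: "step_mgf S ((1 - t) * u + t * a) ((1 - t) * v + t * b) \<le> step_mgf S u' v'"
    if "0 \<le> t" "t \<le> 1" "0 \<le> u'" "0 \<le> v'" for t u' v'
  proof -
    have "step_mgf S ((1 - t) * u + t * a) ((1 - t) * v + t * b) \<le> (1 - t) * step_mgf S u v + t * step_mgf S a b"
      by (rule step_mgf_convex) fact+
    also have "\<dots> \<le> (1 - t) * step_mgf S u v + t * step_mgf S u v"
      using that glob by (intro add_left_mono mult_left_mono) auto
    also have "\<dots> = step_mgf S u v" by (simp add: algebra_simps)
    also have "\<dots> \<le> step_mgf S u' v'" using that min by simp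
    finally show ?thesis .
  qed
  have "a < 0 \<and> 0 \<le> b \<or> 0 < a \<and> b < 0" using log_ratio_neg[OF False] by (simp add: a_def b_def)
  then have "half_plane_growth S 0 \<le> growth quarter_plane S
      \<or> half_plane_growth S (pi / 2) \<le> growth quarter_plane S"
  proof (elim disjE conjE)
    assume ab: "a < 0" "0 \<le> b"
    \<comment> \<open>The parameter at which the segment meets the axis u = 0; the other coordinate
      stays nonnegative because v and b are.\<close>
    define t where "t = u / (u - a)"
    have t: "0 \<le> t" "t \<le> 1" "(1 - t) * u + t * a = 0"
      using ab uv by (auto simp: t_def field_simps)
    then have "0 \<le> (1 - t) * v + t * b" using ab uv by simp
    then have "half_plane_growth S 0 \<le> growth quarter_plane S"
      using seg[OF t(1,2)] t(3)
      by (intro half_plane_growth_le_if_min[OF fin S g, of "(1 - t) * v + t * b"]) auto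
    then show ?thesis ..
  next
    assume ab: "0 < a" "b < 0"
    define t where "t = v / (v - b)"
    have t: "0 \<le> t" "t \<le> 1" "(1 - t) * v + t * b = 0"
      using ab uv by (auto simp: t_def field_simps)
    then have "0 \<le> (1 - t) * u + t * a" using ab uv by simp
    then have "half_plane_growth S (pi / 2) \<le> growth quarter_plane S"
      using seg[OF t(1,2)] t(3)
      by (intro half_plane_growth_le_if_min[OF fin S g, of "(1 - t) * u + t * a"]) auto
    then show ?thesis ..
  qed
  with False show ?thesis by simp
qed

lemma half_plane_growth_le_if_no_drift:
  assumes fin: "finite S" and S: "S \<subseteq> small_steps" and g: "pushing_walk S g"
    and sym: "drift S 0 0 = (0, 0)"
  shows "half_plane_growth S \<theta> \<le> growth quarter_plane S"
  using sym by (intro half_plane_growth_le_if_trivial_tilt fin growth_quarter_plane_ge[OF fin S g]) auto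

lemma horizontal_steps:
  assumes "S \<subseteq> small_steps" "\<forall>s\<in>S. snd s = 0" "(1, 0) \<in> S" "(-1, 0) \<in> S"
  shows "drift S 0 0 = (0, 0)" "pushing_walk S [(1, 0)]"
proof -
  show "drift S 0 0 = (0, 0)"
    using assms drift_small_steps[OF assms(1) refl, of 0 0] by (force simp: prod_eq_iff)
  show "pushing_walk S [(1, 0)]"
    using assms by (auto simp: pushing_walk_def walks_quarter_plane words_def le_Suc_eq)
qed

lemma vertical_steps:
  assumes "S \<subseteq> small_steps" "\<forall>s\<in>S. fst s = 0" "(0, 1) \<in> S" "(0, -1) \<in> S"
  shows "drift S 0 0 = (0, 0)" "pushing_walk S [(0, 1)]"
proof -
  show "drift S 0 0 = (0, 0)"
    using assms drift_small_steps[OF assms(1) refl, of 0 0] by (force simp: prod_eq_iff)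
  show "pushing_walk S [(0, 1)]"
    using assms by (auto simp: pushing_walk_def walks_quarter_plane words_def le_Suc_eq)
qed

lemma sum_tilt_eq_0_imp:
  assumes "finite S" "\<forall>s\<in>S. f s \<le> 0" "(\<Sum>s\<in>S. of_int (f s) * tilt u v s) = 0"
  shows "\<forall>s\<in>S. f s = 0"
proof -
  have "\<forall>s\<in>S. - (of_int (f s) * tilt u v s) = 0"
    using assms by (subst sum_nonneg_eq_0_iff [symmetric]) (auto simp: sum_negf mult_nonpos_nonneg less_imp_le)
  then show ?thesis using tilt_pos[of u v] by (auto simp: less_le)
qed

theorem theorem2p7:
  fixes S :: "(int \<times> int) set"
  assumes "S \<subseteq> {-1, 0, 1} \<times> {-1, 0, 1}"
    and "nontrivial_model quarter_plane quarter_plane_boundaries S"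
  shows "(\<exists>\<theta>\<in>{0..pi / 2}. growth quarter_plane S = half_plane_growth S \<theta> \<and>
      (\<forall>\<phi>\<in>{0..pi / 2}. half_plane_growth S \<theta> \<le> half_plane_growth S \<phi>)) \<and>
    (\<forall>\<alpha> \<beta>. critical_point S \<alpha> \<beta> \<longrightarrow>
       (if log_ratio \<alpha> \<beta> \<ge> 0
        then is_arg_min (half_plane_growth S) (\<lambda>\<theta>. \<theta> \<in> {0..pi / 2}) (ereal_arctan (log_ratio \<alpha> \<beta>))
        else is_arg_min (half_plane_growth S) (\<lambda>\<theta>. \<theta> \<in> {0..pi / 2}) 0 \<or>
             is_arg_min (half_plane_growth S) (\<lambda>\<theta>. \<theta> \<in> {0..pi / 2}) (pi / 2)))"
proof -
  have S: "S \<subseteq> small_steps" by fact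
  have fin: "finite S" using S by (rule finite_subset) auto
  let ?opt = "\<lambda>\<theta>. half_plane_growth S \<theta> \<le> growth quarter_plane S"
  have "(\<exists>\<theta>\<in>{0..pi / 2}. ?opt \<theta>) \<and>
    (\<forall>\<alpha> \<beta>. critical_point S \<alpha> \<beta> \<longrightarrow>
      (if log_ratio \<alpha> \<beta> \<ge> 0 then ?opt (ereal_arctan (log_ratio \<alpha> \<beta>)) else ?opt 0 \<or> ?opt (pi / 2)))"
    using S assms(2)
  proof (cases rule: nontrivial_model_cases)
    case (full g)
    have "g \<in> words S (length g)" "g \<noteq> []"
      using full(1) by (auto simp: pushing_walk_def walks_quarter_plane)
    then obtain u v where uv: "0 \<le> u" "0 \<le> v"
      and min: "\<And>u' v'. 0 \<le> u' \<Longrightarrow> 0 \<le> v' \<Longrightarrow> step_mgf S u v \<le> step_mgf S u' v'"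
      using ex_min_step_mgf_quadrant[OF fin, of g] full(2,3) by metis
    obtain s \<theta> where "0 \<le> s" "\<theta> \<in> {0..pi / 2}" "u = s * sin \<theta>" "v = s * cos \<theta>"
      using polar_quadrant[OF uv] .
    with min have "\<exists>\<theta>\<in>{0..pi / 2}. ?opt \<theta>"
      using half_plane_growth_le_if_min[OF fin S full(1), of s \<theta>] by blast
    moreover have "if log_ratio \<alpha> \<beta> \<ge> 0 then ?opt (ereal_arctan (log_ratio \<alpha> \<beta>)) else ?opt 0 \<or> ?opt (pi / 2)"
      if "critical_point S \<alpha> \<beta>" for \<alpha> \<beta>
      by (rule half_plane_growth_le_if_critical[OF fin S full critical_point_drift[OF that S]])
    ultimately show ?thesis by blast
  next
    case horizontal
    let ?S0 = "{s \<in> S. snd s = 0}"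
    have "?S0 \<subseteq> small_steps" using S by blast
    moreover have "\<forall>s\<in>?S0. snd s = 0" "(1, 0) \<in> ?S0" "(-1, 0) \<in> ?S0" using horizontal by simp_all
    ultimately have S0: "drift ?S0 0 0 = (0, 0)" "pushing_walk ?S0 [(1, 0)]" by (rule horizontal_steps)+
    then have "?opt 0"
      using half_plane_growth_flat_le[OF fin S, of 0] horizontal(1) by simp
    \<comment> \<open>No step goes up, so zero vertical drift at the critical point excludes all
      vertical movement. The untilted drift is then zero and every angle is optimal.\<close>
    moreover have "?opt \<theta>" if "critical_point S \<alpha> \<beta>" for \<alpha> \<beta> \<theta>
    proof -
      have "snd (drift S (ln \<alpha>) (ln \<beta>)) = 0" using critical_point_drift[OF that S] by simp
      then have "\<forall>s\<in>S. snd s = 0"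
        using horizontal(1) by (intro sum_tilt_eq_0_imp[OF fin]) (auto simp: drift_def)
      then show ?thesis
        using horizontal_steps[OF S] horizontal half_plane_growth_le_if_no_drift[OF fin S] by blast
    qed
    ultimately show ?thesis by auto
  next
    case vertical
    let ?S0 = "{s \<in> S. fst s = 0}"
    have "?S0 \<subseteq> small_steps" using S by blast
    moreover have "\<forall>s\<in>?S0. fst s = 0" "(0, 1) \<in> ?S0" "(0, -1) \<in> ?S0" using vertical by simp_all
    ultimately have S0: "drift ?S0 0 0 = (0, 0)" "pushing_walk ?S0 [(0, 1)]" by (rule vertical_steps)+
    then have "?opt (pi / 2)"
      using half_plane_growth_flat_le[OF fin S, of "pi / 2"] vertical(1) by simp
    moreover have "?opt \<theta>" if "critical_point S \<alpha> \<beta>" for \<alpha> \<beta> \<theta>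
    proof -
      have "fst (drift S (ln \<alpha>) (ln \<beta>)) = 0" using critical_point_drift[OF that S] by simp
      then have "\<forall>s\<in>S. fst s = 0"
        using vertical(1) by (intro sum_tilt_eq_0_imp[OF fin]) (auto simp: drift_def)
      then show ?thesis
        using vertical_steps[OF S] vertical half_plane_growth_le_if_no_drift[OF fin S] by blast
    qed
    ultimately show ?thesis by (auto intro!: bexI[of _ "pi / 2"])
  qed
  then have ex: "\<exists>\<theta>\<in>{0..pi / 2}. ?opt \<theta>"
    and crit: "\<And>\<alpha> \<beta>. critical_point S \<alpha> \<beta> \<Longrightarrow> if log_ratio \<alpha> \<beta> \<ge> 0
      then ?opt (ereal_arctan (log_ratio \<alpha> \<beta>)) else ?opt 0 \<or> ?opt (pi / 2)"
    by blast+
  note arg_min = optimal_angle(2)[OF fin]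
  show ?thesis
  proof (intro conjI allI impI)
    show "\<exists>\<theta>\<in>{0..pi / 2}. growth quarter_plane S = half_plane_growth S \<theta> \<and>
      (\<forall>\<phi>\<in>{0..pi / 2}. half_plane_growth S \<theta> \<le> half_plane_growth S \<phi>)"
      using ex optimal_angle(1)[OF fin] growth_quarter_plane_le_half_plane[OF fin] by metis
  next
    fix \<alpha> \<beta> assume "critical_point S \<alpha> \<beta>"
    note opt = crit[OF this]
    show "if log_ratio \<alpha> \<beta> \<ge> 0
        then is_arg_min (half_plane_growth S) (\<lambda>\<theta>. \<theta> \<in> {0..pi / 2}) (ereal_arctan (log_ratio \<alpha> \<beta>))
        else is_arg_min (half_plane_growth S) (\<lambda>\<theta>. \<theta> \<in> {0..pi / 2}) 0 \<or>
             is_arg_min (half_plane_growth S) (\<lambda>\<theta>. \<theta> \<in> {0..pi / 2}) (pi / 2)"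
    proof (cases "log_ratio \<alpha> \<beta> \<ge> 0")
      case True
      then show ?thesis using opt arg_min[OF ereal_arctan_log_ratio(1)[OF True]] by simp
    next
      case False
      then have "?opt 0 \<or> ?opt (pi / 2)" using opt by simp
      moreover have "0 \<in> {0..pi / 2}" "pi / 2 \<in> {0..pi / 2}" by simp_all
      ultimately show ?thesis using False arg_min by auto
    qed
  qed
qed

end
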